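(* Let $W_j(t)$, $t\in[0,1]$, $j\in\mathbb N$, be uncorrelated standard Wiener processes on a common probability space, and for $d\in\mathbb N$ let $$\mathbb W_d(t):=\sum_{j=1}^d W_j(t_j),\quad t=(t_1,\dots,t_d)\in[0,1]^d.$$ Then $n^{\mathbb W_d}(\varepsilon)=1$ for all $\varepsilon\in[3^{-1/2},1)$ and $d\in\mathbb N$. For any fixed $\varepsilon\in(0,3^{-1/2})$, $$n^{\mathbb W_d}(\varepsilon)\sim d\cdot q(\varepsilon),\quad d\to\infty,$$ where $$q(\varepsilon):=\frac16\int_0^{1-3\varepsilon^2}\exp\{F^{-1}(y)\}\,dy,\qquad F(x):=\frac{6}{\pi^2}\sum_{k=1}^\infty\frac1{k^2}\,\mathbf 1(\pi^2k^2\leqslant e^x),\quad x\in\mathbb R.$$ Moreover, $$q(\varepsilon)\sim\frac{2}{\pi^2}\,\varepsilon^{-2},\quad \varepsilon\to0.$$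
   Context: $\mathbb N$ is the set of positive integers. Uncorrelated means $\mathbb E\,W_j(t)W_k(s)=0$ for $j\neq k$ and all $t,s\in[0,1]$; each $W_j$ has zero mean and covariance function $\min\{t,s\}$. $F^{-1}(y):=\inf\{x\in\mathbb R:F(x)\geqslant y\}$, $y\in(0,1)$, is the generalized inverse of $F$. $\langle\cdot,\cdot\rangle_{2,d}$ and $\|\cdot\|_{2,d}$ are the scalar product and norm of $L_2([0,1]^d)$. For a zero-mean random field $V_d$ with sample paths in $L_2([0,1]^d)$ put $e^{V_d}(0):=(\mathbb E\|V_d\|_{2,d}^2)^{1/2}$ and, for $n\in\mathbb N$, $$e^{V_d}(n):=\inf\Bigl\{\Bigl(\mathbb E\Bigl\|V_d-\sum_{m=1}^n\langle V_d,\psi_m\rangle_{2,d}\,\psi_m\Bigr\|_{2,d}^2\Bigr)^{1/2}:\ \psi_1,\dots,\psi_n\in L_2([0,1]^d)\Bigr\}.$$ The average case approximation complexity is $$n^{V_d}(\varepsilon):=\min\{n\in\mathbb N:\ e^{V_d}(n)\leqslant\varepsilon\, e^{V_d}(0)\},\quad \varepsilon\in(0,1).$$ The relation $a\sim b$ means that the ratio $a/b$ tends to $1$ in the indicated limit. *)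

theory Defs
  imports "HOL-Probability.Probability" "HOL-Library.Landau_Symbols"
begin

text \<open>
  Continuity of the paths is only required almost surely, so that path functionals need not be
  measurable on an incomplete space; see \<open>root_mean_square\<close> below.
\<close>

definition standard_Wiener :: "'a measure \<Rightarrow> (real \<Rightarrow> 'a \<Rightarrow> real) \<Rightarrow> bool" where
  "standard_Wiener M W \<longleftrightarrow>
     prob_space M \<and>
     (\<forall>t\<in>{0..1}. W t \<in> borel_measurable M) \<and>
     (AE \<omega> in M. W 0 \<omega> = 0) \<and>
     (\<forall>(n::nat) t. (\<forall>i\<le>n. t i \<in> {0..1}) \<and> (\<forall>i<n. t i \<le> t (Suc i)) \<longrightarrow>
        prob_space.indep_vars M (\<lambda>_. borel) (\<lambda>i \<omega>. W (t (Suc i)) \<omega> - W (t i) \<omega>) {..<n}) \<and>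
     (\<forall>s t. 0 \<le> s \<and> s < t \<and> t \<le> 1 \<longrightarrow>
        distributed M lborel (\<lambda>\<omega>. W t \<omega> - W s \<omega>) (normal_density 0 (sqrt (t - s)))) \<and>
     (AE \<omega> in M. continuous_on {0..1} (\<lambda>t. W t \<omega>))"

definition uncorrelated_processes ::
    "'a measure \<Rightarrow> 'i set \<Rightarrow> ('i \<Rightarrow> real \<Rightarrow> 'a \<Rightarrow> real) \<Rightarrow> bool" where
  "uncorrelated_processes M J W \<longleftrightarrow>
     (\<forall>j\<in>J. \<forall>k\<in>J. j \<noteq> k \<longrightarrow>
        (\<forall>t\<in>{0..1}. \<forall>s\<in>{0..1}. prob_space.expectation M (\<lambda>\<omega>. W j t \<omega> * W k s \<omega>) = 0))"

text \<open>
  Points of \<open>[0,1]\<^sup>d\<close> are functions on the index set \<open>{1..d}\<close>, since \<open>d\<close> varies.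
\<close>

definition cube :: "nat \<Rightarrow> (nat \<Rightarrow> real) measure" where
  "cube d = PiM {1..d} (\<lambda>_. restrict_space lborel {0..1})"

definition L2_space :: "nat \<Rightarrow> ((nat \<Rightarrow> real) \<Rightarrow> real) set" where
  "L2_space d = {f \<in> borel_measurable (cube d). integrable (cube d) (\<lambda>t. (f t)\<^sup>2)}"

definition L2_inner :: "nat \<Rightarrow> ((nat \<Rightarrow> real) \<Rightarrow> real) \<Rightarrow> ((nat \<Rightarrow> real) \<Rightarrow> real) \<Rightarrow> real" where
  "L2_inner d f g = (\<integral>t. f t * g t \<partial>cube d)"

definition L2_norm :: "nat \<Rightarrow> ((nat \<Rightarrow> real) \<Rightarrow> real) \<Rightarrow> real" where
  "L2_norm d f = sqrt (L2_inner d f f)"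

text \<open>
  The expectation of the (nonnegative) squared norm is a \<open>nn_integral\<close>, which is insensitive to
  null sets even without measurability of the integrand. It is finite whenever
  the field has paths in \<open>L2_space d\<close> and a square-integrable norm, as is the case for every field
  considered here, so \<open>enn2real\<close> loses nothing.
\<close>

definition root_mean_square :: "'a measure \<Rightarrow> nat \<Rightarrow> ((nat \<Rightarrow> real) \<Rightarrow> 'a \<Rightarrow> real) \<Rightarrow> real" where
  "root_mean_square M d V =
     sqrt (enn2real (\<integral>\<^sup>+\<omega>. ennreal ((L2_norm d (\<lambda>t. V t \<omega>))\<^sup>2) \<partial>M))"

definition approx_error ::
    "'a measure \<Rightarrow> nat \<Rightarrow> ((nat \<Rightarrow> real) \<Rightarrow> 'a \<Rightarrow> real) \<Rightarrow> nat \<Rightarrow> real" where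
  "approx_error M d V n =
     (if n = 0 then root_mean_square M d V
      else Inf {root_mean_square M d
                  (\<lambda>t \<omega>. V t \<omega> - (\<Sum>m=1..n. L2_inner d (\<lambda>u. V u \<omega>) (\<psi> m) * \<psi> m t))
               | \<psi>. \<forall>m\<in>{1..n}. \<psi> m \<in> L2_space d})"

definition approx_complexity ::
    "'a measure \<Rightarrow> nat \<Rightarrow> ((nat \<Rightarrow> real) \<Rightarrow> 'a \<Rightarrow> real) \<Rightarrow> real \<Rightarrow> nat" where
  "approx_complexity M d V \<epsilon> =
     (LEAST n. 1 \<le> n \<and> approx_error M d V n \<le> \<epsilon> * approx_error M d V 0)"

definition additive_field ::
    "(nat \<Rightarrow> real \<Rightarrow> 'a \<Rightarrow> real) \<Rightarrow> nat \<Rightarrow> (nat \<Rightarrow> real) \<Rightarrow> 'a \<Rightarrow> real" where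
  "additive_field W d t \<omega> = (\<Sum>j=1..d. W j (t j) \<omega>)"

definition generalized_inverse :: "(real \<Rightarrow> real) \<Rightarrow> real \<Rightarrow> real" where
  "generalized_inverse G y = Inf {x. y \<le> G x}"

definition Wiener_F :: "real \<Rightarrow> real" where
  "Wiener_F x = 6 / pi\<^sup>2 * (\<Sum>k. 1 / (real (Suc k))\<^sup>2 * of_bool (pi\<^sup>2 * (real (Suc k))\<^sup>2 \<le> exp x))"

definition Wiener_q :: "real \<Rightarrow> real" where
  "Wiener_q \<epsilon> = 1 / 6 * (LBINT y=0..ereal (1 - 3 * \<epsilon>\<^sup>2). exp (generalized_inverse Wiener_F y))"

end

theory Submission
  imports Defs "HOL-Real_Asymp.Real_Asymp"
begin

text \<open>
  Split each \<open>W\<^sub>j\<close> into its mean over the unit interval and the centred rest. The means add up to a single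
  random constant of variance \<open>d/3\<close> out of the total \<open>d/2\<close>, so one function already gives the relative
  error \<open>3 powr (-1/2)\<close>. The centred parts contribute \<open>d\<close> copies of the eigenvalues \<open>1 / (\<pi>k)\<^sup>2\<close>, whose
  sum is \<open>1/6\<close> by Basel. Approximating with the constant and the centred eigenfunctions bounds the complexity
  from above by \<open>d q(\<epsilon>) + 2\<close>. For the lower bound project everything onto finitely many cosine modes, which
  have uncorrelated coefficients: an \<open>n\<close>-dimensional space captures at most the \<open>n\<close> largest of their
  eigenvalues, and this gives \<open>d q(\<epsilon>)\<close>. Finally \<open>q(\<epsilon>)\<close> differs by a bounded amount from the
  index at which the tail of the eigenvalue series drops to \<open>\<epsilon>\<^sup>2/2\<close>, and the tail after
  \<open>K\<close> is \<open>1 / (\<pi>\<^sup>2 K)\<close> to leading order.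
\<close>

section \<open>Eigenvalues and the function q\<close>

text \<open>The spectrum of the full field is never computed: its covariance couples the shared
  random constant with the cosine modes. Treating the constant by hand costs a single function,
  which disappears after division by d. The shape of q comes from reading F as a normalised spectral
  distribution: the eigenvalues, divided by their sum 1/6, are placed as masses at the logarithms of
  their reciprocals. Integrating reciprocal eigenvalues against captured variance counts
  eigenvalues. So q(\<epsilon>) is the number per coordinate, the last one counted fractionally,
  that carries the share 1 - 3 \<epsilon>^2 of the centred variance; the rest, \<epsilon>^2/2, is
  the tolerated error per coordinate. The obstacle in the lower bound is that the infimum ranges
  over arbitrary \<psi>, possibly dependent and not normalised, with approximation coefficients that
  need not be optimal. The \<psi> are therefore replaced by their coordinate vectors on finitely
  many modes and orthogonalised there, and their coefficients are compared with the best possible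
  ones.\<close>

text \<open>
  The centred Wiener process \<open>W - \<integral>W\<close> has the covariance eigenvalues \<open>1 / (\<pi>k)\<^sup>2\<close>, \<open>k \<ge> 1\<close>, with
  eigenfunctions \<open>\<surd>2 cos (\<pi>kt)\<close>.
\<close>

definition eigval :: "nat \<Rightarrow> real" where
  "eigval k = 1 / (pi * real k)\<^sup>2"

definition eigsum :: "nat \<Rightarrow> real" where
  "eigsum K = (\<Sum>k=1..K. eigval k)"

lemma eigval_nonneg: "0 \<le> eigval k"
  by (simp add: eigval_def)

lemma eigval_pos: "k > 0 \<Longrightarrow> 0 < eigval k"
  by (simp add: eigval_def)

lemma eigval_antimono: "0 < j \<Longrightarrow> j \<le> k \<Longrightarrow> eigval k \<le> eigval j"
  unfolding eigval_def by (intro divide_left_mono power_mono mult_left_mono) auto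

lemma eigsum_0 [simp]: "eigsum 0 = 0"
  by (simp add: eigsum_def)

lemma eigsum_Suc: "eigsum (Suc K) = eigsum K + eigval (Suc K)"
  by (simp add: eigsum_def)

lemma eigsum_mono: "j \<le> k \<Longrightarrow> eigsum j \<le> eigsum k"
  unfolding eigsum_def by (intro sum_mono2) (auto simp: eigval_nonneg)

lemma eigsum_nonneg: "0 \<le> eigsum K"
  using eigsum_mono[of 0 K] by simp

lemma eigsum_eq: "eigsum K = (\<Sum>k<K. 1 / (real (Suc k))\<^sup>2) / pi\<^sup>2"
  by (induction K) (auto simp: eigsum_Suc eigval_def add_divide_distrib power_mult_distrib)

lemma Basel_sums: "(\<lambda>k. 1 / (real (Suc k))\<^sup>2) sums (pi\<^sup>2 / 6)"
  using inverse_squares_sums by (simp add: add.commute)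

lemma eigsum_LIMSEQ: "eigsum \<longlonglongrightarrow> 1 / 6"
proof -
  have "(\<lambda>K. (\<Sum>k<K. 1 / (real (Suc k))\<^sup>2) / pi\<^sup>2) \<longlonglongrightarrow> (pi\<^sup>2 / 6) / pi\<^sup>2"
    by (intro tendsto_divide tendsto_const) (use Basel_sums in \<open>auto simp: sums_def\<close>)
  then show ?thesis
    by (simp add: eigsum_eq[abs_def])
qed

text \<open>Telescoping: adding \<open>1 / (pi\<^sup>2 * real (Suc K))\<close> to the partial sum
  gives an increasing sequence, because 1/n - 1/(n+1) \<le> 1/n^2, and its limit is 1/6.\<close>

lemma eigsum_tail_lower: "1 / (pi\<^sup>2 * real (Suc K)) \<le> 1 / 6 - eigsum K"
proof -
  let ?X = "\<lambda>K. eigsum K + 1 / (pi\<^sup>2 * real (Suc K))"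
  have lim: "?X \<longlonglongrightarrow> 1 / 6 + 0"
    by (intro tendsto_add eigsum_LIMSEQ) real_asymp
  have "incseq ?X"
  proof (rule incseq_SucI)
    fix K
    have "1 / real (Suc K) \<le> 1 / (real (Suc K))\<^sup>2 + 1 / real (Suc (Suc K))"
      by (simp add: divide_simps power2_eq_square) (simp add: algebra_simps)
    then have "1 / real (Suc K) / pi\<^sup>2 \<le> (1 / (real (Suc K))\<^sup>2 + 1 / real (Suc (Suc K))) / pi\<^sup>2"
      by (intro divide_right_mono) auto
    then show "?X K \<le> ?X (Suc K)"
      by (simp add: eigsum_Suc eigval_def power_mult_distrib add_divide_distrib mult.commute del: of_nat_Suc)
  qed
  from incseq_le[OF this lim, of K] show ?thesis by simp
qed

lemma eigsum_tail_upper: "K > 0 \<Longrightarrow> 1 / 6 - eigsum K \<le> 1 / (pi\<^sup>2 * real K)"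
proof -
  assume K: "K > 0"
  \<comment> \<open>The index is shifted by one because at K = 0 the added term would be 1/0 = 0,
    which breaks the monotonicity.\<close>
  let ?X = "\<lambda>K. eigsum (Suc K) + 1 / (pi\<^sup>2 * real (Suc K))"
  have lim: "?X \<longlonglongrightarrow> 1 / 6 + 0"
    by (intro tendsto_add filterlim_compose[OF eigsum_LIMSEQ filterlim_Suc]) real_asymp
  have "decseq ?X"
  proof (rule decseq_SucI)
    fix K
    have "1 / (real (Suc (Suc K)))\<^sup>2 + 1 / real (Suc (Suc K)) \<le> 1 / real (Suc K)"
      by (simp add: divide_simps power2_eq_square) (simp add: algebra_simps)
    then have "(1 / (real (Suc (Suc K)))\<^sup>2 + 1 / real (Suc (Suc K))) / pi\<^sup>2 \<le> 1 / real (Suc K) / pi\<^sup>2"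
      by (intro divide_right_mono) auto
    then show "?X (Suc K) \<le> ?X K"
      by (simp add: eigsum_Suc[of "Suc K"] eigval_def power_mult_distrib add_divide_distrib mult.commute del: of_nat_Suc)
  qed
  from decseq_ge[OF this lim, of "K - 1"] K show ?thesis by simp
qed

text \<open>K counts the eigenvalues exhausted before the level y is reached; the next one is used
  in part or just exhausted. The half-open form matches the non-strict inequality in the generalized
  inverse.\<close>

lemma exists_eigsum_bracket:
  assumes "0 < y" "y < 1 / 6"
  obtains K where "eigsum K < y" "y \<le> eigsum (Suc K)"
proof -
  have "\<exists>n. y \<le> eigsum n"
  proof -
    have "eventually (\<lambda>n. y < eigsum n) sequentially"
      using eigsum_LIMSEQ assms(2) by (rule order_tendstoD)
    then show ?thesis by (auto simp: eventually_sequentially intro: less_imp_le)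
  qed
  then obtain n where n: "y \<le> eigsum n" "\<And>i. i < n \<Longrightarrow> \<not> y \<le> eigsum i"
    using exists_least_iff[of "\<lambda>n. y \<le> eigsum n"] by auto
  with assms have "n \<noteq> 0" by (auto intro!: Nat.gr0I)
  with n that[of "n - 1"] show ?thesis by (simp add: not_le)
qed

text \<open>F is a step function: it jumps by \<open>6 * eigval k\<close> at
  \<open>ln ((pi * real k)\<^sup>2)\<close> and equals \<open>6 * eigsum k\<close> from there up to
  the next jump. A level in the given block is therefore first reached at jump number
  \<open>Suc K\<close>.\<close>

lemma Wiener_F_ge_iff:
  assumes y: "6 * eigsum K < y" "y \<le> 6 * eigsum (Suc K)"
  shows "y \<le> Wiener_F x \<longleftrightarrow> ln ((pi * real (Suc K))\<^sup>2) \<le> x"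
proof -
  let ?f = "\<lambda>k. 1 / (real (Suc k))\<^sup>2 * of_bool (pi\<^sup>2 * (real (Suc k))\<^sup>2 \<le> exp x) :: real"
  have summ: "summable ?f"
    by (rule summable_comparison_test'[OF sums_summable[OF Basel_sums], of 0])
       (auto simp: of_bool_def)
  have pos: "0 < (pi * real (Suc K))\<^sup>2" by simp
  have eq: "ln ((pi * real (Suc K))\<^sup>2) \<le> x \<longleftrightarrow> (pi * real (Suc K))\<^sup>2 \<le> exp x"
    using pos by (metis exp_le_cancel_iff exp_ln)
  show ?thesis
  proof
    assume "ln ((pi * real (Suc K))\<^sup>2) \<le> x"
    then have le: "pi\<^sup>2 * (real (Suc K))\<^sup>2 \<le> exp x"
      using eq by (simp add: power_mult_distrib)
    have one: "pi\<^sup>2 * (real (Suc k))\<^sup>2 \<le> exp x" if "k < Suc K" for k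
    proof -
      have "pi\<^sup>2 * (real (Suc k))\<^sup>2 \<le> pi\<^sup>2 * (real (Suc K))\<^sup>2"
        using that by (intro mult_left_mono power_mono) auto
      with le show ?thesis by linarith
    qed
    have "6 * eigsum (Suc K) = 6 / pi\<^sup>2 * (\<Sum>k<Suc K. ?f k)"
      unfolding eigsum_eq using one by (simp del: of_nat_Suc sum.lessThan_Suc)
    also have "\<dots> \<le> Wiener_F x"
      unfolding Wiener_F_def by (intro mult_left_mono sum_le_suminf summ) auto
    finally show "y \<le> Wiener_F x" using y by linarith
  next
    assume yF: "y \<le> Wiener_F x"
    show "ln ((pi * real (Suc K))\<^sup>2) \<le> x"
    proof (rule ccontr)
      assume "\<not> ?thesis"
      then have gt: "exp x < pi\<^sup>2 * (real (Suc K))\<^sup>2"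
        using eq by (simp add: power_mult_distrib)
      have zero: "?f k = 0" if "k \<notin> {..<K}" for k
      proof -
        have "pi\<^sup>2 * (real (Suc K))\<^sup>2 \<le> pi\<^sup>2 * (real (Suc k))\<^sup>2"
          using that by (intro mult_left_mono power_mono) auto
        with gt have "\<not> pi\<^sup>2 * (real (Suc k))\<^sup>2 \<le> exp x" by linarith
        then show ?thesis by simp
      qed
      have "Wiener_F x = 6 / pi\<^sup>2 * (\<Sum>k<K. ?f k)"
        unfolding Wiener_F_def using zero by (subst suminf_finite[of "{..<K}"]) auto
      also have "\<dots> \<le> 6 / pi\<^sup>2 * (\<Sum>k<K. 1 / (real (Suc k))\<^sup>2)"
        by (intro mult_left_mono sum_mono) auto
      also have "\<dots> = 6 * eigsum K"
        by (simp add: eigsum_eq)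
      finally show False using y yF by linarith
    qed
  qed
qed

lemma exp_generalized_inverse_Wiener_F:
  assumes "6 * eigsum K < y" "y \<le> 6 * eigsum (Suc K)"
  shows "exp (generalized_inverse Wiener_F y) = 1 / eigval (Suc K)"
proof -
  have "{x. y \<le> Wiener_F x} = {ln ((pi * real (Suc K))\<^sup>2)..}"
    using Wiener_F_ge_iff[OF assms] by auto
  then have "generalized_inverse Wiener_F y = ln ((pi * real (Suc K))\<^sup>2)"
    by (simp add: generalized_inverse_def cInf_atLeast)
  then show ?thesis
    by (simp add: eigval_def)
qed

text \<open>The integrand has the value \<open>1 / eigval k\<close> on a block of length
  \<open>6 * eigval k\<close>, so every full block contributes exactly 6. The induction appends one
  block at a time, and \<open>has_bochner_integral\<close> carries integrability along with the
  value.\<close>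

lemma integral_exp_generalized_inverse:
  "6 * eigsum K < y \<Longrightarrow> y \<le> 6 * eigsum (Suc K) \<Longrightarrow>
    has_bochner_integral lborel
      (\<lambda>x. indicator {0<..y} x * exp (generalized_inverse Wiener_F x))
      (6 * (real K + (y / 6 - eigsum K) / eigval (Suc K)))"
proof (induction K arbitrary: y)
  case (Suc K)
  let ?z = "6 * eigsum (Suc K)"
  let ?g = "\<lambda>x. exp (generalized_inverse Wiener_F x)"
  have z: "6 * eigsum K < ?z" using eigval_pos[of "Suc K"] by (simp add: eigsum_Suc)
  have z0: "0 \<le> ?z" using eigsum_nonneg by simp
  have "has_bochner_integral lborel (\<lambda>x. indicator {?z<..y} x *\<^sub>R (1 / eigval (Suc (Suc K))))
      (measure lborel {?z<..y} *\<^sub>R (1 / eigval (Suc (Suc K))))"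
    using Suc.prems by (intro has_bochner_integral_scaleR_left has_bochner_integral_real_indicator) auto
  note sum = has_bochner_integral_add[OF Suc.IH[OF z order.refl] this]
  have "indicator {0<..?z} x * ?g x + indicator {?z<..y} x *\<^sub>R (1 / eigval (Suc (Suc K)))
      = indicator {0<..y} x * ?g x" for x
    using exp_generalized_inverse_Wiener_F[of "Suc K" x] Suc.prems z0
    by (auto simp: indicator_def)
  moreover have "6 * (real K + (?z / 6 - eigsum K) / eigval (Suc K)) + measure lborel {?z<..y} *\<^sub>R (1 / eigval (Suc (Suc K)))
      = 6 * (real (Suc K) + (y / 6 - eigsum (Suc K)) / eigval (Suc (Suc K)))"
    using eigval_pos[of "Suc K"] eigval_pos[of "Suc (Suc K)"] Suc.prems by (simp add: eigsum_Suc field_simps)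
  ultimately show ?case using sum by (simp only:)
next
  case 0
  then have "has_bochner_integral lborel (\<lambda>x. indicator {0<..y} x *\<^sub>R (1 / eigval 1))
      (measure lborel {0<..y} *\<^sub>R (1 / eigval 1))"
    by (intro has_bochner_integral_scaleR_left has_bochner_integral_real_indicator) auto
  moreover have "indicator {0<..y} x *\<^sub>R (1 / eigval 1) = indicator {0<..y} x * exp (generalized_inverse Wiener_F x)" for x
    using exp_generalized_inverse_Wiener_F[of 0 x] 0 by (auto simp: indicator_def)
  ultimately show ?case using 0 by simp
qed

text \<open>The prefactor 1/6 cancels the contribution 6 of each block. What remains counts the
  eigenvalues, with a fractional last one, needed to collect the variance
  \<open>1 / 6 - \<epsilon>\<^sup>2 / 2\<close>.\<close>

lemma Wiener_q_eq:
  assumes "eigsum K < 1 / 6 - \<epsilon>\<^sup>2 / 2" "1 / 6 - \<epsilon>\<^sup>2 / 2 \<le> eigsum (Suc K)"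
  shows "Wiener_q \<epsilon> = real K + (1 / 6 - \<epsilon>\<^sup>2 / 2 - eigsum K) / eigval (Suc K)"
proof -
  define y where "y = 1 - 3 * \<epsilon>\<^sup>2"
  have y: "6 * eigsum K < y" "y \<le> 6 * eigsum (Suc K)" and y6: "y / 6 = 1 / 6 - \<epsilon>\<^sup>2 / 2"
    using assms by (auto simp: y_def)
  have "0 < y" using y eigsum_nonneg[of K] by linarith
  then have "(LBINT x=0..ereal y. exp (generalized_inverse Wiener_F x))
      = (LBINT x:{0<..y}. exp (generalized_inverse Wiener_F x))"
    using interval_integral_Ioc[of 0 y "\<lambda>x. exp (generalized_inverse Wiener_F x)"]
    by (simp add: zero_ereal_def)
  also have "\<dots> = 6 * (real K + (y / 6 - eigsum K) / eigval (Suc K))"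
    using has_bochner_integral_integral_eq[OF integral_exp_generalized_inverse[OF y]]
    by (simp add: set_lebesgue_integral_def)
  finally show ?thesis
    by (simp add: Wiener_q_def y_def[symmetric] y6)
qed

text \<open>The bracketing index satisfies K < q \<le> K + 1; the eigenvalue tail after K exceeds
  \<epsilon>^2/2 and the tail after K + 1 does not. The two tail estimates then confine K to within
  2 below \<open>2 / (pi\<^sup>2 * \<epsilon>\<^sup>2)\<close>.\<close>

lemma Wiener_q_bounds:
  assumes "0 < \<epsilon>" "3 * \<epsilon>\<^sup>2 < 1"
  shows "Wiener_q \<epsilon> \<in> {2 / (pi\<^sup>2 * \<epsilon>\<^sup>2) - 2 .. 2 / (pi\<^sup>2 * \<epsilon>\<^sup>2) + 1}" "0 < Wiener_q \<epsilon>"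
proof -
  have x: "0 < \<epsilon>\<^sup>2" using assms(1) by simp
  have "0 < 1 / 6 - \<epsilon>\<^sup>2 / 2" "1 / 6 - \<epsilon>\<^sup>2 / 2 < 1 / 6"
    using assms x by linarith+
  then obtain K where K: "eigsum K < 1 / 6 - \<epsilon>\<^sup>2 / 2" "1 / 6 - \<epsilon>\<^sup>2 / 2 \<le> eigsum (Suc K)"
    by (rule exists_eigsum_bracket)
  note q = Wiener_q_eq[OF K]
  have m: "0 < eigval (Suc K)" by (simp add: eigval_pos)
  have "(1 / 6 - \<epsilon>\<^sup>2 / 2 - eigsum K) / eigval (Suc K) > 0"
    using K m by simp
  moreover have "(1 / 6 - \<epsilon>\<^sup>2 / 2 - eigsum K) / eigval (Suc K) \<le> 1"
    using K m by (simp add: eigsum_Suc)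
  ultimately have q2: "real K < Wiener_q \<epsilon>" "Wiener_q \<epsilon> \<le> real K + 1"
    unfolding q by linarith+
  then show "0 < Wiener_q \<epsilon>" by linarith
  have "1 / (pi\<^sup>2 * real (Suc (Suc K))) \<le> \<epsilon>\<^sup>2 / 2"
    using eigsum_tail_lower[of "Suc K"] K by linarith
  then have lo: "2 / (pi\<^sup>2 * \<epsilon>\<^sup>2) \<le> real K + 2"
  proof -
    have "1 \<le> \<epsilon>\<^sup>2 / 2 * (pi\<^sup>2 * real (Suc (Suc K)))"
      using \<open>1 / (pi\<^sup>2 * real (Suc (Suc K))) \<le> \<epsilon>\<^sup>2 / 2\<close> by (subst (asm) pos_divide_le_eq) auto
    then have "2 \<le> (real K + 2) * (pi\<^sup>2 * \<epsilon>\<^sup>2)" by (simp add: algebra_simps)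
    then show ?thesis using x by (subst pos_divide_le_eq) auto
  qed
  have hi: "real K \<le> 2 / (pi\<^sup>2 * \<epsilon>\<^sup>2)"
  proof (cases "K = 0")
    case False
    with eigsum_tail_upper[of K] K have "\<epsilon>\<^sup>2 / 2 \<le> 1 / (pi\<^sup>2 * real K)" by auto
    with False x show ?thesis by (simp add: field_simps)
  qed simp
  show "Wiener_q \<epsilon> \<in> {2 / (pi\<^sup>2 * \<epsilon>\<^sup>2) - 2 .. 2 / (pi\<^sup>2 * \<epsilon>\<^sup>2) + 1}"
    using q2 lo hi by auto
qed

lemma Wiener_q_asymp: "Wiener_q \<sim>[at_right 0] (\<lambda>\<epsilon>. 2 / pi\<^sup>2 * \<epsilon> powr (-2))"
proof (rule asymp_equivI')
  let ?g = "\<lambda>\<epsilon>::real. 2 / pi\<^sup>2 * \<epsilon> powr (-2)"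
  have ev: "eventually (\<lambda>\<epsilon>::real. 0 < \<epsilon> \<and> 3 * \<epsilon>\<^sup>2 < 1) (at_right 0)"
    by (intro eventually_conj) real_asymp+
  \<comment> \<open>Division by \<open>2 / (pi\<^sup>2 * \<epsilon>\<^sup>2)\<close> turns the
    additive errors 2 and 1 into \<open>pi\<^sup>2 * \<epsilon>\<^sup>2\<close> and half of
    it.\<close>
  have bd: "Wiener_q \<epsilon> / ?g \<epsilon> \<in> {1 - pi\<^sup>2 * \<epsilon>\<^sup>2 .. 1 + pi\<^sup>2 * \<epsilon>\<^sup>2 / 2}"
    if "0 < \<epsilon> \<and> 3 * \<epsilon>\<^sup>2 < 1" for \<epsilon>
  proof -
    have g: "?g \<epsilon> = 2 / (pi\<^sup>2 * \<epsilon>\<^sup>2)"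
      using that by (simp add: powr_minus field_simps)
    show ?thesis
      using Wiener_q_bounds(1)[of \<epsilon>] that unfolding g by (simp add: field_simps)
  qed
  show "((\<lambda>\<epsilon>. Wiener_q \<epsilon> / ?g \<epsilon>) \<longlongrightarrow> 1) (at_right 0)"
  proof (rule tendsto_sandwich)
    show "eventually (\<lambda>\<epsilon>. 1 - pi\<^sup>2 * \<epsilon>\<^sup>2 \<le> Wiener_q \<epsilon> / ?g \<epsilon>) (at_right 0)"
      using ev by eventually_elim (use bd in auto)
    show "eventually (\<lambda>\<epsilon>. Wiener_q \<epsilon> / ?g \<epsilon> \<le> 1 + pi\<^sup>2 * \<epsilon>\<^sup>2 / 2) (at_right 0)"
      using ev by eventually_elim (use bd in auto)
  qed real_asymp+
qed

section \<open>Orthogonal projections\<close>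

lemma square_integrable_mult:
  fixes f g :: "'a \<Rightarrow> real"
  assumes [measurable]: "f \<in> borel_measurable M" "g \<in> borel_measurable M"
    and "integrable M (\<lambda>x. (f x)\<^sup>2)" "integrable M (\<lambda>x. (g x)\<^sup>2)"
  shows "integrable M (\<lambda>x. f x * g x)"
proof (rule Bochner_Integration.integrable_bound)
  show "integrable M (\<lambda>x. (f x)\<^sup>2 + (g x)\<^sup>2)"
    using assms by simp
  have "\<bar>a * b\<bar> \<le> \<bar>a\<^sup>2 + b\<^sup>2\<bar>" for a b :: real
  proof -
    have "2 * (\<bar>a\<bar> * \<bar>b\<bar>) \<le> a\<^sup>2 + b\<^sup>2"
      using sum_squares_bound[of "\<bar>a\<bar>" "\<bar>b\<bar>"] by (simp add: mult.assoc)
    moreover have "0 \<le> \<bar>a\<bar> * \<bar>b\<bar>" by simp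
    ultimately show ?thesis unfolding abs_mult by linarith
  qed
  then show "AE x in M. norm (f x * g x) \<le> norm ((f x)\<^sup>2 + (g x)\<^sup>2)"
    unfolding real_norm_def by (rule AE_I2)
qed simp

lemma L2_space_mult: "f \<in> L2_space d \<Longrightarrow> g \<in> L2_space d \<Longrightarrow> integrable (cube d) (\<lambda>t. f t * g t)"
  by (rule square_integrable_mult) (auto simp: L2_space_def)

lemma L2_space_add: "f \<in> L2_space d \<Longrightarrow> g \<in> L2_space d \<Longrightarrow> (\<lambda>t. f t + g t) \<in> L2_space d"
  using L2_space_mult[of f d g] by (auto simp: L2_space_def power2_sum mult.assoc)

lemma L2_space_cmult: "f \<in> L2_space d \<Longrightarrow> (\<lambda>t. c * f t) \<in> L2_space d"
  by (auto simp: L2_space_def power_mult_distrib)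

lemma L2_space_diff: "f \<in> L2_space d \<Longrightarrow> g \<in> L2_space d \<Longrightarrow> (\<lambda>t. f t - g t) \<in> L2_space d"
  using L2_space_add[OF _ L2_space_cmult[of g d "-1"], of f] by simp

lemma L2_space_zero: "(\<lambda>t. 0) \<in> L2_space d"
  by (simp add: L2_space_def)

lemma L2_space_sum: "(\<And>i. i \<in> I \<Longrightarrow> f i \<in> L2_space d) \<Longrightarrow> (\<lambda>t. \<Sum>i\<in>I. f i t) \<in> L2_space d"
  by (induction I rule: infinite_finite_induct) (auto intro: L2_space_zero L2_space_add)

lemma L2_inner_commute: "L2_inner d f g = L2_inner d g f"
  by (simp add: L2_inner_def mult.commute)

lemma L2_inner_nonneg: "0 \<le> L2_inner d f f"
  by (simp add: L2_inner_def)

lemma L2_norm_power2: "(L2_norm d f)\<^sup>2 = L2_inner d f f"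
  by (simp add: L2_norm_def L2_inner_nonneg)

lemma L2_inner_diff_left:
  "f \<in> L2_space d \<Longrightarrow> g \<in> L2_space d \<Longrightarrow> h \<in> L2_space d \<Longrightarrow>
    L2_inner d (\<lambda>t. f t - g t) h = L2_inner d f h - L2_inner d g h"
  by (simp add: L2_inner_def left_diff_distrib L2_space_mult)

lemma L2_inner_diff_right:
  "f \<in> L2_space d \<Longrightarrow> g \<in> L2_space d \<Longrightarrow> h \<in> L2_space d \<Longrightarrow>
    L2_inner d h (\<lambda>t. f t - g t) = L2_inner d h f - L2_inner d h g"
  by (simp add: L2_inner_def right_diff_distrib L2_space_mult)

lemma L2_inner_sum_left:
  assumes "\<And>i. i \<in> I \<Longrightarrow> f i \<in> L2_space d" "g \<in> L2_space d"
  shows "L2_inner d (\<lambda>t. \<Sum>i\<in>I. c i * f i t) g = (\<Sum>i\<in>I. c i * L2_inner d (f i) g)"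
proof -
  have "L2_inner d (\<lambda>t. \<Sum>i\<in>I. c i * f i t) g = (\<integral>t. (\<Sum>i\<in>I. c i * (f i t * g t)) \<partial>cube d)"
    by (simp add: L2_inner_def sum_distrib_right mult.assoc)
  also have "\<dots> = (\<Sum>i\<in>I. c i * L2_inner d (f i) g)"
    using assms by (subst Bochner_Integration.integral_sum) (auto intro: L2_space_mult simp: L2_inner_def)
  finally show ?thesis .
qed

lemma L2_inner_sum_right:
  assumes "\<And>i. i \<in> I \<Longrightarrow> f i \<in> L2_space d" "g \<in> L2_space d"
  shows "L2_inner d g (\<lambda>t. \<Sum>i\<in>I. c i * f i t) = (\<Sum>i\<in>I. c i * L2_inner d g (f i))"
  using L2_inner_sum_left[OF assms] by (simp add: L2_inner_commute[of d g])

text \<open>Pythagoras: with P the projection, both the inner product of h with P and that of P with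
  itself equal the sum of the squared coefficients. The equality serves the upper bound on the
  error; its consequence, Bessel's inequality, serves the lower bound.\<close>

lemma L2_projection_residual:
  assumes I: "finite I" and e: "\<And>i. i \<in> I \<Longrightarrow> e i \<in> L2_space d" and h: "h \<in> L2_space d"
    and orth: "\<And>i k. i \<in> I \<Longrightarrow> k \<in> I \<Longrightarrow> L2_inner d (e i) (e k) = of_bool (i = k)"
  shows "L2_inner d (\<lambda>t. h t - (\<Sum>i\<in>I. L2_inner d h (e i) * e i t))
                    (\<lambda>t. h t - (\<Sum>i\<in>I. L2_inner d h (e i) * e i t))
    = L2_inner d h h - (\<Sum>i\<in>I. (L2_inner d h (e i))\<^sup>2)"
proof -
  let ?c = "\<lambda>i. L2_inner d h (e i)"
  let ?P = "\<lambda>t. \<Sum>i\<in>I. ?c i * e i t"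
  have P: "?P \<in> L2_space d"
    using e by (intro L2_space_sum L2_space_cmult)
  have hP: "L2_inner d h ?P = (\<Sum>i\<in>I. (?c i)\<^sup>2)"
    using e h by (subst L2_inner_sum_right) (auto simp: power2_eq_square)
  have eP: "L2_inner d (e i) ?P = ?c i" if "i \<in> I" for i
  proof -
    have "L2_inner d (e i) ?P = (\<Sum>k\<in>I. ?c k * of_bool (i = k))"
      using e that orth by (subst L2_inner_sum_right) auto
    also have "\<dots> = ?c i"
      using I that by (simp add: of_bool_def if_distrib cong: if_cong)
    finally show ?thesis .
  qed
  have PP: "L2_inner d ?P ?P = (\<Sum>i\<in>I. (?c i)\<^sup>2)"
    using e P eP by (subst L2_inner_sum_left) (auto simp: power2_eq_square)
  show ?thesis
    using h P L2_space_diff[OF h P] hP PP L2_inner_commute[of d ?P h]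
    by (simp add: L2_inner_diff_left L2_inner_diff_right)
qed

lemma L2_Bessel:
  assumes "finite I" "\<And>i. i \<in> I \<Longrightarrow> e i \<in> L2_space d" "h \<in> L2_space d"
    and "\<And>i k. i \<in> I \<Longrightarrow> k \<in> I \<Longrightarrow> L2_inner d (e i) (e k) = of_bool (i = k)"
  shows "(\<Sum>i\<in>I. (L2_inner d h (e i))\<^sup>2) \<le> L2_inner d h h"
  using L2_projection_residual[OF assms] L2_inner_nonneg[of d "\<lambda>t. h t - (\<Sum>i\<in>I. L2_inner d h (e i) * e i t)"]
  by simp

text \<open>Bessel's inequality for the single vector g divided by its norm. If the norm is 0, then
  g vanishes almost everywhere and both sides are 0.\<close>

lemma L2_Cauchy_Schwarz:
  assumes f: "f \<in> L2_space d" and g: "g \<in> L2_space d"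
  shows "(L2_inner d f g)\<^sup>2 \<le> L2_inner d f f * L2_inner d g g"
proof (cases "L2_inner d g g = 0")
  case True
  have "AE t in cube d. (g t)\<^sup>2 = 0"
    using g True by (subst integral_nonneg_eq_0_iff_AE[symmetric])
      (auto simp: L2_inner_def L2_space_def power2_eq_square)
  then have "L2_inner d f g = (\<integral>t. 0 \<partial>cube d)"
    using f g unfolding L2_inner_def by (intro integral_cong_AE) (auto simp: L2_space_def)
  with True show ?thesis by simp
next
  case False
  then have pos: "0 < L2_inner d g g"
    using L2_inner_nonneg[of d g] by simp
  let ?s = "sqrt (L2_inner d g g)"
  have gs: "(\<lambda>t. 1 / ?s * g t) \<in> L2_space d"
    by (intro L2_space_cmult g)
  have "L2_inner d (\<lambda>t. 1 / ?s * g t) (\<lambda>t. 1 / ?s * g t) = 1 / ?s * (1 / ?s) * L2_inner d g g"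
    unfolding L2_inner_def by (subst integral_mult_right_zero[symmetric]) (simp only: ac_simps)
  then have one: "L2_inner d (\<lambda>t. 1 / ?s * g t) (\<lambda>t. 1 / ?s * g t) = 1"
    using pos by (simp add: field_simps)
  have fs: "L2_inner d f (\<lambda>t. 1 / ?s * g t) = 1 / ?s * L2_inner d f g"
    unfolding L2_inner_def by (subst integral_mult_right_zero[symmetric]) (simp only: ac_simps)
  have "(L2_inner d f (\<lambda>t. 1 / ?s * g t))\<^sup>2 \<le> L2_inner d f f"
    using L2_Bessel[of "{()}" "\<lambda>_ t. 1 / ?s * g t" d f] gs f one by simp
  then have "(L2_inner d f g)\<^sup>2 / L2_inner d g g \<le> L2_inner d f f"
    unfolding fs using pos by (simp add: power_mult_distrib power_divide)
  then show ?thesis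
    using pos by (simp add: pos_divide_le_eq)
qed

text \<open>
  Normalising the zero vector by division by its norm leaves it zero, so linearly dependent vectors
  need no special treatment: they contribute zero vectors to \<open>\<phi>\<close>.
\<close>

lemma gram_schmidt_finite:
  fixes a :: "nat \<Rightarrow> 'i \<Rightarrow> real"
  assumes I: "finite I"
  shows "\<exists>\<phi>. (\<forall>l<n. \<forall>m<n. l \<noteq> m \<longrightarrow> (\<Sum>i\<in>I. \<phi> l i * \<phi> m i) = 0) \<and>
             (\<forall>l<n. (\<Sum>i\<in>I. (\<phi> l i)\<^sup>2) \<in> {0, 1}) \<and>
             (\<forall>m<n. \<exists>c. \<forall>i\<in>I. a m i = (\<Sum>l<n. c l * \<phi> l i))"
proof (induction n)
  case (Suc n)
  obtain \<phi> where \<phi>: "(\<forall>l<n. \<forall>m<n. l \<noteq> m \<longrightarrow> (\<Sum>i\<in>I. \<phi> l i * \<phi> m i) = 0) \<and>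
             (\<forall>l<n. (\<Sum>i\<in>I. (\<phi> l i)\<^sup>2) \<in> {0, 1}) \<and>
             (\<forall>m<n. \<exists>c. \<forall>i\<in>I. a m i = (\<Sum>l<n. c l * \<phi> l i))"
    using Suc.IH by (elim exE)
  then have orth: "l < n \<Longrightarrow> m < n \<Longrightarrow> l \<noteq> m \<Longrightarrow> (\<Sum>i\<in>I. \<phi> l i * \<phi> m i) = 0"
    and norm: "l < n \<Longrightarrow> (\<Sum>i\<in>I. (\<phi> l i)\<^sup>2) \<in> {0, 1}" for l m
    by auto
  from \<phi> have span: "\<forall>m<n. \<exists>c. \<forall>i\<in>I. a m i = (\<Sum>l<n. c l * \<phi> l i)"
    by (elim conjE)
  define p where "p l = (\<Sum>i\<in>I. a n i * \<phi> l i)" for l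
  define r where "r i = a n i - (\<Sum>l<n. p l * \<phi> l i)" for i
  define s where "s = sqrt (\<Sum>i\<in>I. (r i)\<^sup>2)"
  define \<phi>' where "\<phi>' = \<phi>(n := (\<lambda>i. r i / s))"
  have same: "\<phi>' l = \<phi> l" if "l < n" for l
    using that by (simp add: \<phi>'_def)
  have new: "\<phi>' n i = r i / s" for i
    by (simp add: \<phi>'_def)
  have p0: "p l = 0" if "l < n" "(\<Sum>i\<in>I. (\<phi> l i)\<^sup>2) = 0" for l
    using that I by (auto simp: p_def sum_nonneg_eq_0_iff intro!: sum.neutral)
  \<comment> \<open>For a zero vector \<open>\<phi> l\<close> the diagonal term is 0 instead of
    \<open>p l\<close>, but then \<open>p l\<close> is 0 as well, so the subtraction cancels in
    either case.\<close>
  have r_orth: "(\<Sum>i\<in>I. r i * \<phi> l i) = 0" if l: "l < n" for l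
  proof -
    have "(\<Sum>i\<in>I. r i * \<phi> l i) = p l - (\<Sum>i\<in>I. \<Sum>m<n. p m * (\<phi> m i * \<phi> l i))"
      by (simp add: r_def p_def left_diff_distrib sum_subtractf sum_distrib_right mult.assoc)
    also have "(\<Sum>i\<in>I. \<Sum>m<n. p m * (\<phi> m i * \<phi> l i)) = (\<Sum>m<n. p m * (\<Sum>i\<in>I. \<phi> m i * \<phi> l i))"
      by (subst sum.swap) (simp add: sum_distrib_left)
    also have "\<dots> = (\<Sum>m<n. if m = l then p l * (\<Sum>i\<in>I. (\<phi> l i)\<^sup>2) else 0)"
      using orth l by (intro sum.cong) (auto simp: power2_eq_square)
    also have "\<dots> = p l"
      using l norm[OF l] p0[OF l] by auto
    finally show ?thesis by simp
  qed
  have s: "r i = s * (r i / s)" if "i \<in> I" for i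
  proof (cases "s = 0")
    case True
    then have "(\<Sum>i\<in>I. (r i)\<^sup>2) = 0" by (simp add: s_def)
    with that I show ?thesis by (simp add: sum_nonneg_eq_0_iff True)
  qed simp
  have orth_n: "(\<Sum>i\<in>I. r i / s * \<phi> l i) = 0" if "l < n" for l
    using r_orth[OF that] by (simp add: sum_divide_distrib[symmetric])
  have "(\<Sum>i\<in>I. (r i / s)\<^sup>2) = (\<Sum>i\<in>I. (r i)\<^sup>2) / s\<^sup>2"
    by (simp add: power_divide sum_divide_distrib)
  also have "\<dots> \<in> {0, 1}"
    by (cases "(\<Sum>i\<in>I. (r i)\<^sup>2) = 0") (auto simp: s_def sum_nonneg)
  finally have norm_n: "(\<Sum>i\<in>I. (r i / s)\<^sup>2) \<in> {0, 1}" .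
  show ?case
  proof (intro exI[of _ \<phi>'] conjI allI impI)
    fix l m assume lm: "l < Suc n" "m < Suc n" "l \<noteq> m"
    then consider "l < n" "m < n" | "l = n" "m < n" | "l < n" "m = n" by linarith
    then show "(\<Sum>i\<in>I. \<phi>' l i * \<phi>' m i) = 0"
    proof cases
      case 1 then show ?thesis using orth lm by (simp add: same)
    next
      case 2 then show ?thesis using orth_n[of m] by (simp add: same new)
    next
      case 3 then show ?thesis using orth_n[of l] by (simp add: same new mult.commute)
    qed
  next
    fix l assume "l < Suc n"
    then show "(\<Sum>i\<in>I. (\<phi>' l i)\<^sup>2) \<in> {0, 1}"
      using norm norm_n by (cases "l = n") (auto simp: same new)
  next
    fix m assume "m < Suc n"
    then consider "m < n" | "m = n" by linarith
    then show "\<exists>c. \<forall>i\<in>I. a m i = (\<Sum>l<Suc n. c l * \<phi>' l i)"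
    proof cases
      case 1
      then obtain c where c: "\<forall>i\<in>I. a m i = (\<Sum>l<n. c l * \<phi> l i)" using span by blast
      show ?thesis
        by (rule exI[of _ "c(n := 0)"]) (simp add: c same)
    next
      case 2
      have "a m i = (\<Sum>l<Suc n. (p(n := s)) l * \<phi>' l i)" if "i \<in> I" for i
      proof -
        have "(\<Sum>l<Suc n. (p(n := s)) l * \<phi>' l i) = (\<Sum>l<n. p l * \<phi> l i) + s * (r i / s)"
          by (simp add: same new)
        also have "\<dots> = a n i"
          by (simp only: s[OF that, symmetric]) (simp add: r_def)
        finally show ?thesis using 2 by simp
      qed
      then show ?thesis by blast
    qed
  qed
qed simp

lemma sum_power2_orthogonal:
  fixes \<phi> :: "nat \<Rightarrow> 'i \<Rightarrow> real"
  assumes orth: "\<And>l m. l < n \<Longrightarrow> m < n \<Longrightarrow> l \<noteq> m \<Longrightarrow> (\<Sum>i\<in>I. \<phi> l i * \<phi> m i) = 0"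
  shows "(\<Sum>i\<in>I. (\<Sum>l<n. z l * \<phi> l i)\<^sup>2) = (\<Sum>l<n. (z l)\<^sup>2 * (\<Sum>i\<in>I. (\<phi> l i)\<^sup>2))"
proof -
  have "(\<Sum>i\<in>I. (\<Sum>l<n. z l * \<phi> l i)\<^sup>2) = (\<Sum>i\<in>I. \<Sum>l<n. \<Sum>m<n. z l * z m * (\<phi> l i * \<phi> m i))"
    by (simp add: power2_eq_square sum_product mult_ac)
  also have "\<dots> = (\<Sum>l<n. \<Sum>i\<in>I. \<Sum>m<n. z l * z m * (\<phi> l i * \<phi> m i))"
    by (rule sum.swap)
  also have "\<dots> = (\<Sum>l<n. \<Sum>m<n. \<Sum>i\<in>I. z l * z m * (\<phi> l i * \<phi> m i))"
    by (intro sum.cong refl sum.swap)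
  also have "\<dots> = (\<Sum>l<n. \<Sum>m<n. if m = l then (z l)\<^sup>2 * (\<Sum>i\<in>I. (\<phi> l i)\<^sup>2) else 0)"
    using orth by (intro sum.cong refl) (auto simp: power2_eq_square sum_distrib_left[symmetric])
  also have "\<dots> = (\<Sum>l<n. (z l)\<^sup>2 * (\<Sum>i\<in>I. (\<phi> l i)\<^sup>2))"
    by simp
  finally show ?thesis .
qed

text \<open>No choice of coefficients z beats the projection coefficients p: for unit vectors this
  is 2 z p \<le> z^2 + p^2 term by term, and for zero vectors p = 0. Arbitrary z are allowed because
  the coefficients produced by general \<psi> are not under control.\<close>

lemma orthonormal_residual:
  fixes \<phi> :: "nat \<Rightarrow> 'i \<Rightarrow> real"
  assumes I: "finite I"
    and orth: "\<And>l m. l < n \<Longrightarrow> m < n \<Longrightarrow> l \<noteq> m \<Longrightarrow> (\<Sum>i\<in>I. \<phi> l i * \<phi> m i) = 0"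
    and norm: "\<And>l. l < n \<Longrightarrow> (\<Sum>i\<in>I. (\<phi> l i)\<^sup>2) \<in> {0, 1}"
  shows "(\<Sum>i\<in>I. (X i)\<^sup>2) - (\<Sum>l<n. (\<Sum>i\<in>I. X i * \<phi> l i)\<^sup>2) \<le> (\<Sum>i\<in>I. (X i - (\<Sum>l<n. z l * \<phi> l i))\<^sup>2)"
proof -
  let ?p = "\<lambda>l. \<Sum>i\<in>I. X i * \<phi> l i" and ?s = "\<lambda>l. \<Sum>i\<in>I. (\<phi> l i)\<^sup>2"
  have cross: "(\<Sum>i\<in>I. X i * (\<Sum>l<n. z l * \<phi> l i)) = (\<Sum>l<n. z l * ?p l)"
    unfolding sum_distrib_left by (subst sum.swap) (simp add: ac_simps)
  have sq: "(\<Sum>i\<in>I. (\<Sum>l<n. z l * \<phi> l i)\<^sup>2) = (\<Sum>l<n. (z l)\<^sup>2 * ?s l)"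
    using orth by (rule sum_power2_orthogonal)
  have "2 * (z l * ?p l) \<le> (z l)\<^sup>2 * ?s l + (?p l)\<^sup>2" if l: "l < n" for l
  proof (cases "?s l = 0")
    case True
    then have "?p l = 0" using I by (auto simp: sum_nonneg_eq_0_iff intro!: sum.neutral)
    then show ?thesis by (simp add: True)
  next
    case False
    then have "?s l = 1" using norm[OF l] by simp
    then show ?thesis using sum_squares_bound[of "z l" "?p l"] by simp
  qed
  then have "(\<Sum>l<n. 2 * (z l * ?p l)) \<le> (\<Sum>l<n. (z l)\<^sup>2 * ?s l + (?p l)\<^sup>2)"
    by (intro sum_mono) auto
  moreover have "(\<Sum>i\<in>I. (X i - (\<Sum>l<n. z l * \<phi> l i))\<^sup>2)
      = (\<Sum>i\<in>I. (X i)\<^sup>2) - 2 * (\<Sum>i\<in>I. X i * (\<Sum>l<n. z l * \<phi> l i)) + (\<Sum>i\<in>I. (\<Sum>l<n. z l * \<phi> l i)\<^sup>2)"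
    by (simp add: power2_diff sum.distrib sum_subtractf sum_distrib_left mult.assoc)
  ultimately show ?thesis
    unfolding cross sq by (simp only: sum.distrib sum_distrib_left[symmetric])
qed

text \<open>Bessel's inequality for the k-th unit vector, whose inner product with
  \<open>\<phi> l\<close> is the coordinate \<open>\<phi> l k\<close>. It says that a subspace
  captures at most the whole of any single mode.\<close>

lemma orthonormal_coordinate_le_1:
  fixes \<phi> :: "nat \<Rightarrow> 'i \<Rightarrow> real"
  assumes I: "finite I"
    and orth: "\<And>l m. l < n \<Longrightarrow> m < n \<Longrightarrow> l \<noteq> m \<Longrightarrow> (\<Sum>i\<in>I. \<phi> l i * \<phi> m i) = 0"
    and norm: "\<And>l. l < n \<Longrightarrow> (\<Sum>i\<in>I. (\<phi> l i)\<^sup>2) \<in> {0, 1}"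
    and k: "k \<in> I"
  shows "(\<Sum>l<n. (\<phi> l k)\<^sup>2) \<le> 1"
proof -
  let ?X = "\<lambda>i. of_bool (i = k) :: real"
  have z: "(\<Sum>i\<in>I. ?X i * f i) = f k" for f
  proof -
    have "(\<Sum>i\<in>I. ?X i * f i) = (\<Sum>i\<in>I. if i = k then f i else 0)"
      by (intro sum.cong) auto
    then show ?thesis using I k by simp
  qed
  have one: "(\<Sum>i\<in>I. (?X i)\<^sup>2) = 1"
    using z[of ?X] by (simp add: power2_eq_square)
  let ?z = "\<lambda>l. \<phi> l k"
  let ?R = "\<Sum>i\<in>I. (?X i - (\<Sum>l<n. ?z l * \<phi> l i))\<^sup>2"
  have sq: "(\<Sum>i\<in>I. (\<Sum>l<n. ?z l * \<phi> l i)\<^sup>2) \<le> (\<Sum>l<n. (?z l)\<^sup>2)"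
  proof -
    have "(\<Sum>i\<in>I. (\<Sum>l<n. ?z l * \<phi> l i)\<^sup>2) = (\<Sum>l<n. (?z l)\<^sup>2 * (\<Sum>i\<in>I. (\<phi> l i)\<^sup>2))"
      using orth by (rule sum_power2_orthogonal)
    also have "\<dots> \<le> (\<Sum>l<n. (?z l)\<^sup>2)"
    proof (rule sum_mono)
      fix l assume "l \<in> {..<n}"
      then have "(\<Sum>i\<in>I. (\<phi> l i)\<^sup>2) = 0 \<or> (\<Sum>i\<in>I. (\<phi> l i)\<^sup>2) = 1" using norm by simp
      then show "(?z l)\<^sup>2 * (\<Sum>i\<in>I. (\<phi> l i)\<^sup>2) \<le> (?z l)\<^sup>2" by auto
    qed
    finally show ?thesis .
  qed
  have "0 \<le> ?R" by (intro sum_nonneg) auto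
  also have "?R = (\<Sum>i\<in>I. (?X i)\<^sup>2) - 2 * (\<Sum>i\<in>I. ?X i * (\<Sum>l<n. ?z l * \<phi> l i)) + (\<Sum>i\<in>I. (\<Sum>l<n. ?z l * \<phi> l i)\<^sup>2)"
    by (simp only: power2_diff sum.distrib sum_subtractf sum_distrib_left[symmetric] mult.assoc)
  also have "(\<Sum>i\<in>I. ?X i * (\<Sum>l<n. ?z l * \<phi> l i)) = (\<Sum>l<n. (?z l)\<^sup>2)"
    by (subst z) (simp add: power2_eq_square)
  finally show ?thesis using sq one by simp
qed

section \<open>Integrals over the unit interval\<close>

abbreviation unit_interval :: "real measure" where
  "unit_interval \<equiv> restrict_space lborel {0..1}"

lemma prob_space_unit_interval: "prob_space unit_interval"
  by (rule prob_spaceI) (simp add: emeasure_restrict_space space_restrict_space)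

lemma space_unit_interval: "space unit_interval = {0..1}"
  by (simp add: space_restrict_space)

lemma borel_measurable_unit_interval:
  fixes f :: "real \<Rightarrow> real"
  shows "continuous_on {0..1} f \<Longrightarrow> f \<in> borel_measurable unit_interval"
  using borel_measurable_continuous_on_restrict[of "{0..1}" f]
    measurable_cong_sets[of unit_interval "restrict_space borel {0..1}" borel borel]
  by (simp add: sets_restrict_space)

lemma
  fixes f :: "real \<Rightarrow> real"
  assumes "continuous_on {0..1} f"
  shows integrable_unit_interval: "integrable unit_interval f"
    and integral_unit_interval: "integral\<^sup>L unit_interval f = integral {0..1} f"
proof -
  have "set_integrable lborel {0..1} f"
    using assms by (rule borel_integrable_atLeastAtMost')
  then show "integrable unit_interval f" "integral\<^sup>L unit_interval f = integral {0..1} f"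
    using set_borel_integral_eq_integral(2)[of "{0..1}" f]
    by (auto simp: integrable_restrict_space integral_restrict_space set_integrable_def set_lebesgue_integral_def)
qed

lemma has_integral_unit_interval_FTC:
  fixes f F :: "real \<Rightarrow> real"
  assumes "\<And>t. t \<in> {0..1} \<Longrightarrow> (F has_real_derivative f t) (at t)"
  shows "(f has_integral (F 1 - F 0)) {0..1}"
  using assms by (intro fundamental_theorem_of_calculus)
    (auto simp: has_real_derivative_iff_has_vector_derivative[symmetric] intro: DERIV_subset)

lemma integral_unit_interval_FTC:
  fixes f F :: "real \<Rightarrow> real"
  assumes "\<And>t. t \<in> {0..1} \<Longrightarrow> (F has_real_derivative f t) (at t)" "continuous_on {0..1} f"
  shows "integral\<^sup>L unit_interval f = F 1 - F 0"
  using has_integral_unit_interval_FTC[OF assms(1)] integral_unit_interval[OF assms(2)]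
  by (simp add: integral_unique)

section \<open>The Wiener covariance kernel and the cosine system\<close>

lemma integral_min_kernel:
  fixes f F G :: "real \<Rightarrow> real"
  assumes F: "\<And>s. (F has_real_derivative f s) (at s)"
    and G: "\<And>s. (G has_real_derivative F s) (at s)"
    and f: "continuous_on {0..1} f" and t: "t \<in> {0..1}"
  shows "(\<integral>s. min t s * f s \<partial>unit_interval) = t * F 1 - G t + G 0"
proof -
  \<comment> \<open>Integration by parts on [0,t]: \<open>s * F s - G s\<close> is an antiderivative
    of \<open>s * f s\<close>. On [t,1] the kernel is the constant t, so \<open>t * F s\<close>
    serves there.\<close>
  have "((\<lambda>s. s * F s - G s) has_real_derivative s * f s) (at s)" for s
    by (auto intro!: derivative_eq_intros F G)
  then have "((\<lambda>s. s * f s) has_integral (t * F t - G t - (0 * F 0 - G 0))) {0..t}"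
    using t by (intro fundamental_theorem_of_calculus[where f = "\<lambda>s. s * F s - G s"])
      (auto simp: has_real_derivative_iff_has_vector_derivative[symmetric] intro: DERIV_subset)
  then have 1: "((\<lambda>s. min t s * f s) has_integral (t * F t - G t + G 0)) {0..t}"
    by (subst has_integral_cong[where g = "\<lambda>s. s * f s"]) auto
  have "((\<lambda>s. t * F s) has_real_derivative t * f s) (at s)" for s
    by (auto intro!: derivative_eq_intros F)
  then have "((\<lambda>s. t * f s) has_integral (t * F 1 - t * F t)) {t..1}"
    using t by (intro fundamental_theorem_of_calculus[where f = "\<lambda>s. t * F s"])
      (auto simp: has_real_derivative_iff_has_vector_derivative[symmetric] intro: DERIV_subset)
  then have 2: "((\<lambda>s. min t s * f s) has_integral (t * F 1 - t * F t)) {t..1}"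
    by (subst has_integral_cong[where g = "\<lambda>s. t * f s"]) auto
  have "((\<lambda>s. min t s * f s) has_integral (t * F t - G t + G 0 + (t * F 1 - t * F t))) {0..1}"
    using t by (intro has_integral_combine[OF _ _ 1 2]) auto
  moreover have "continuous_on {0..1} (\<lambda>s. min t s * f s)"
    by (intro continuous_intros f)
  ultimately show ?thesis
    by (simp add: integral_unit_interval integral_unique)
qed

text \<open>The factor \<open>sqrt 2\<close> normalises the modes k \<ge> 1 only. The constant mode
  is treated separately and is not \<open>cosine 0\<close>.\<close>

definition cosine :: "nat \<Rightarrow> real \<Rightarrow> real" where
  "cosine k t = sqrt 2 * cos (pi * real k * t)"

lemma continuous_on_cosine: "continuous_on A (cosine k)"
  unfolding cosine_def by (intro continuous_intros)

lemma sin_pi_mult_nat: "sin (pi * real n) = 0"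
  using sin_npi[of n] by (simp add: mult.commute)

lemma integral_cos: "k > 0 \<Longrightarrow> (\<integral>t. cos (pi * real k * t) \<partial>unit_interval) = 0"
  by (subst integral_unit_interval_FTC[where F = "\<lambda>t. sin (pi * real k * t) / (pi * real k)"])
    (auto intro!: derivative_eq_intros continuous_intros simp: sin_pi_mult_nat)

lemma integral_cosine: "k > 0 \<Longrightarrow> (\<integral>t. cosine k t \<partial>unit_interval) = 0"
  unfolding cosine_def by (subst integral_mult_right_zero) (simp add: integral_cos)

lemma integral_cosine_cosine:
  assumes "k > 0" "l > 0"
  shows "(\<integral>t. cosine k t * cosine l t \<partial>unit_interval) = of_bool (k = l)"
proof -
  \<comment> \<open>The product-to-sum formula contains the natural number difference
    \<open>k - l\<close>, hence the restriction to l \<le> k; the other case follows by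
    symmetry.\<close>
  have *: "(\<integral>t. cosine k t * cosine l t \<partial>unit_interval) = of_bool (k = l)" if "0 < l" "l \<le> k" for k l
  proof -
    have "cosine k t * cosine l t = cos (pi * real (k - l) * t) + cos (pi * real (k + l) * t)" for t
    proof -
      have "cos (pi * real (k - l) * t) + cos (pi * real (k + l) * t)
          = 2 * (cos (pi * real k * t) * cos (pi * real l * t))"
        using cos_times_cos[of "pi * real k * t" "pi * real l * t"] that
        by (simp add: algebra_simps of_nat_diff)
      then show ?thesis by (simp add: cosine_def)
    qed
    then have "(\<integral>t. cosine k t * cosine l t \<partial>unit_interval)
        = (\<integral>t. cos (pi * real (k - l) * t) \<partial>unit_interval) + (\<integral>t. cos (pi * real (k + l) * t) \<partial>unit_interval)"
      by (simp only:) (intro Bochner_Integration.integral_add integrable_unit_interval continuous_intros)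
    also have "\<dots> = of_bool (k = l)"
      using that integral_cos[of "k - l"] integral_cos[of "k + l"] prob_space.prob_space[OF prob_space_unit_interval]
      by (cases "k = l") (auto simp: measure_restrict_space space_restrict_space)
    finally show ?thesis .
  qed
  show ?thesis
  proof (cases "l \<le> k")
    case False
    then have "(\<integral>t. cosine l t * cosine k t \<partial>unit_interval) = of_bool (l = k)"
      using assms by (intro *) auto
    then show ?thesis by (simp add: mult.commute eq_commute)
  qed (use * assms in auto)
qed

text \<open>This is the variance of the mean of a Wiener process over [0,1], and the origin of the 3
  in the threshold for \<epsilon>.\<close>

lemma min_kernel_1:
  "(\<integral>t. (\<integral>s. min t s \<partial>unit_interval) \<partial>unit_interval) = 1 / 3"
proof -
  have "(\<integral>t. (\<integral>s. min t s \<partial>unit_interval) \<partial>unit_interval) = (\<integral>t. t - t\<^sup>2 / 2 \<partial>unit_interval)"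
  proof (intro Bochner_Integration.integral_cong refl)
    fix t assume "t \<in> space unit_interval"
    moreover have "((\<lambda>s. s\<^sup>2 / 2) has_real_derivative s) (at s)" for s :: real
      by (auto intro!: derivative_eq_intros)
    ultimately show "(\<integral>s. min t s \<partial>unit_interval) = t - t\<^sup>2 / 2"
      using integral_min_kernel[of "\<lambda>s. s" "\<lambda>_. 1" "\<lambda>s. s\<^sup>2 / 2" t]
      by (auto simp: space_unit_interval intro!: derivative_eq_intros)
  qed
  also have "\<dots> = 1 / 3"
    by (subst integral_unit_interval_FTC[where F = "\<lambda>t. t\<^sup>2 / 2 - t ^ 3 / 6"])
      (auto intro!: derivative_eq_intros continuous_intros)
  finally show ?thesis .
qed

text \<open>The uncentred kernel maps \<open>cosine l\<close> to
  \<open>eigval l * (cosine l t - sqrt 2)\<close>, so the cosines are not its eigenfunctions. The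
  deviation is a constant, which is orthogonal to every \<open>cosine k\<close> with k > 0, and the
  quadratic form is diagonal all the same.\<close>

lemma min_kernel_cosine:
  assumes "k > 0" "l > 0"
  shows "(\<integral>t. cosine k t * (\<integral>s. min t s * cosine l s \<partial>unit_interval) \<partial>unit_interval)
    = of_bool (k = l) * eigval k"
proof -
  let ?a = "pi * real l"
  have a: "?a \<noteq> 0" using assms by simp
  have "(\<integral>t. cosine k t * (\<integral>s. min t s * cosine l s \<partial>unit_interval) \<partial>unit_interval)
      = (\<integral>t. eigval l * (cosine k t * cosine l t) - sqrt 2 * eigval l * cosine k t \<partial>unit_interval)"
  proof (intro Bochner_Integration.integral_cong refl)
    fix t assume "t \<in> space unit_interval"
    then have "(\<integral>s. min t s * cosine l s \<partial>unit_interval)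
      = t * (sqrt 2 * sin (?a * 1) / ?a) - (- (sqrt 2 * cos (?a * t) / ?a\<^sup>2)) + (- (sqrt 2 * cos (?a * 0) / ?a\<^sup>2))"
      using a unfolding cosine_def
      by (intro integral_min_kernel[where F = "\<lambda>s. sqrt 2 * sin (?a * s) / ?a" and G = "\<lambda>s. - (sqrt 2 * cos (?a * s) / ?a\<^sup>2)"])
        (auto simp: space_unit_interval power2_eq_square intro!: derivative_eq_intros continuous_intros)
    also have "\<dots> = eigval l * cosine l t - sqrt 2 * eigval l"
      by (simp add: eigval_def cosine_def sin_pi_mult_nat)
    finally have inner: "(\<integral>s. min t s * cosine l s \<partial>unit_interval) = eigval l * cosine l t - sqrt 2 * eigval l" .
    show "cosine k t * (\<integral>s. min t s * cosine l s \<partial>unit_interval)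
      = eigval l * (cosine k t * cosine l t) - sqrt 2 * eigval l * cosine k t"
      unfolding inner by (simp add: algebra_simps)
  qed
  also have "\<dots> = eigval l * (\<integral>t. cosine k t * cosine l t \<partial>unit_interval)
      - sqrt 2 * eigval l * (\<integral>t. cosine k t \<partial>unit_interval)"
    by (subst Bochner_Integration.integral_diff)
      (auto intro!: integrable_unit_interval continuous_intros continuous_on_cosine)
  finally show ?thesis
    using assms by (simp add: integral_cosine integral_cosine_cosine)
qed

section \<open>Functions of one coordinate on the cube\<close>

lemma prob_space_cube: "prob_space (cube d)"
  unfolding cube_def by (intro prob_space_PiM prob_space_unit_interval)

lemma measurable_cube_component:
  "j \<in> {1..d} \<Longrightarrow> (\<lambda>t. t j) \<in> cube d \<rightarrow>\<^sub>M unit_interval"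
  unfolding cube_def by (rule measurable_component_singleton)

lemma distr_cube_component: "j \<in> {1..d} \<Longrightarrow> distr (cube d) unit_interval (\<lambda>t. t j) = unit_interval"
  unfolding cube_def by (intro distr_PiM_component prob_space_unit_interval)

lemma
  fixes a :: "real \<Rightarrow> real"
  assumes "j \<in> {1..d}" "a \<in> borel_measurable unit_interval"
  shows integral_cube_component: "(\<integral>t. a (t j) \<partial>cube d) = integral\<^sup>L unit_interval a"
    and integrable_cube_component: "integrable (cube d) (\<lambda>t. a (t j)) \<longleftrightarrow> integrable unit_interval a"
  using integral_distr[OF measurable_cube_component[OF assms(1)] assms(2)]
    integrable_distr_eq[OF measurable_cube_component[OF assms(1)] assms(2)]
  by (simp_all only: distr_cube_component[OF assms(1)])

lemma L2_space_component:
  assumes "j \<in> {1..d}" "a \<in> borel_measurable unit_interval" "integrable unit_interval (\<lambda>s. (a s)\<^sup>2)"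
  shows "(\<lambda>t. a (t j)) \<in> L2_space d"
  using assms integrable_cube_component[of j d "\<lambda>s. (a s)\<^sup>2"]
    measurable_compose[OF measurable_cube_component assms(2)]
  by (simp add: L2_space_def)

lemma L2_inner_component_same:
  assumes "j \<in> {1..d}" "a \<in> borel_measurable unit_interval" "b \<in> borel_measurable unit_interval"
  shows "L2_inner d (\<lambda>t. a (t j)) (\<lambda>t. b (t j)) = (\<integral>s. a s * b s \<partial>unit_interval)"
  unfolding L2_inner_def using assms by (subst integral_cube_component[where a = "\<lambda>s. a s * b s"]) auto

text \<open>Fubini on the product space: the integrand is a product over all coordinates with the
  factor 1 at those other than j and l, and these factors integrate to 1.\<close>

lemma L2_inner_component_diff:
  assumes "j \<in> {1..d}" "l \<in> {1..d}" "j \<noteq> l" "integrable unit_interval a" "integrable unit_interval b"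
  shows "L2_inner d (\<lambda>t. a (t j)) (\<lambda>t. b (t l)) = integral\<^sup>L unit_interval a * integral\<^sup>L unit_interval b"
proof -
  interpret U: prob_space unit_interval by (rule prob_space_unit_interval)
  interpret product_sigma_finite "\<lambda>_::nat. unit_interval" ..
  let ?F = "\<lambda>i. if i = j then a else if i = l then b else (\<lambda>_. 1)"
  have prod_jl: "(\<Prod>i\<in>{1..d}. G i) = G j * G l"
    if "\<And>i. i \<noteq> j \<Longrightarrow> i \<noteq> l \<Longrightarrow> G i = 1" for G :: "nat \<Rightarrow> real"
  proof -
    have "(\<Prod>i\<in>{1..d}. G i) = (\<Prod>i\<in>{j, l}. G i)"
      using assms that by (intro prod.mono_neutral_right) auto
    then show ?thesis using assms by simp
  qed
  have "L2_inner d (\<lambda>t. a (t j)) (\<lambda>t. b (t l)) = (\<integral>t. (\<Prod>i\<in>{1..d}. ?F i (t i)) \<partial>cube d)"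
    unfolding L2_inner_def using assms
    by (intro Bochner_Integration.integral_cong refl, subst prod_jl) auto
  also have "\<dots> = (\<Prod>i\<in>{1..d}. integral\<^sup>L unit_interval (?F i))"
    unfolding cube_def using assms by (intro product_integral_prod) auto
  also have "\<dots> = integral\<^sup>L unit_interval a * integral\<^sup>L unit_interval b"
    using assms U.prob_space by (subst prod_jl) auto
  finally show ?thesis .
qed

section \<open>Wiener processes with continuous paths\<close>

text \<open>
  A standard Wiener process is only measurable at each fixed time, with paths continuous off a null
  set. Setting it to \<open>0\<close> on that null set makes it jointly measurable, as Fubini requires.
\<close>

locale continuous_wiener_family = prob_space M for M :: "'a measure" +
  fixes B :: "nat \<Rightarrow> real \<Rightarrow> 'a \<Rightarrow> real"
  assumes continuous_paths: "1 \<le> j \<Longrightarrow> continuous_on {0..1} (\<lambda>t. B j t \<omega>)"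
    and jointly_measurable: "1 \<le> j \<Longrightarrow> (\<lambda>(\<omega>, t). B j t \<omega>) \<in> borel_measurable (M \<Otimes>\<^sub>M unit_interval)"
    and square_integrable: "1 \<le> j \<Longrightarrow> t \<in> {0..1} \<Longrightarrow> integrable M (\<lambda>\<omega>. (B j t \<omega>)\<^sup>2)"
    and covariance: "1 \<le> j \<Longrightarrow> 1 \<le> l \<Longrightarrow> t \<in> {0..1} \<Longrightarrow> s \<in> {0..1} \<Longrightarrow>
      expectation (\<lambda>\<omega>. B j t \<omega> * B l s \<omega>) = of_bool (j = l) * min t s"
begin

interpretation U: prob_space unit_interval by (rule prob_space_unit_interval)
interpretation MU: pair_sigma_finite M unit_interval ..

definition coef :: "nat \<Rightarrow> (real \<Rightarrow> real) \<Rightarrow> 'a \<Rightarrow> real" where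
  "coef j f \<omega> = (\<integral>t. B j t \<omega> * f t \<partial>unit_interval)"

definition energy :: "nat \<Rightarrow> 'a \<Rightarrow> real" where
  "energy j \<omega> = (\<integral>t. (B j t \<omega>)\<^sup>2 \<partial>unit_interval)"

lemma slice_measurable:
  assumes "1 \<le> j" "t \<in> {0..1}"
  shows "B j t \<in> borel_measurable M"
proof -
  have "(\<lambda>\<omega>. (\<omega>, t)) \<in> M \<rightarrow>\<^sub>M M \<Otimes>\<^sub>M unit_interval"
    using assms by (intro measurable_Pair) (auto simp: space_unit_interval)
  from measurable_compose[OF this jointly_measurable[OF assms(1)]] show ?thesis
    by simp
qed

text \<open>The second moment t is known at fixed times, so Fubini's criterion is applied with the
  integral over the probability space inside. This gives integrability on the product in the other
  order, which is then swapped back.\<close>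

lemma integrable_square: 
  assumes j: "1 \<le> j"
  shows "integrable (M \<Otimes>\<^sub>M unit_interval) (\<lambda>(\<omega>, t). (B j t \<omega>)\<^sup>2)"
proof -
  note [measurable] = jointly_measurable[OF j]
  interpret UM: pair_sigma_finite unit_interval M ..
  have swap: "(\<lambda>(t, \<omega>). B j t \<omega>) \<in> borel_measurable (unit_interval \<Otimes>\<^sub>M M)"
    using measurable_compose[OF measurable_pair_swap' jointly_measurable[OF j]] by (simp add: case_prod_beta')
  have sq: "(\<lambda>(t, \<omega>). (B j t \<omega>)\<^sup>2) \<in> borel_measurable (unit_interval \<Otimes>\<^sub>M M)"
    using borel_measurable_power[OF swap, of 2] by (simp add: case_prod_beta')
  have "integrable (unit_interval \<Otimes>\<^sub>M M) (\<lambda>(t, \<omega>). (B j t \<omega>)\<^sup>2)"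
  proof (rule UM.Fubini_integrable[OF sq])
    have "integrable unit_interval (\<lambda>t. t)"
      by (intro integrable_unit_interval continuous_intros)
    then show "integrable unit_interval (\<lambda>t. \<integral>\<omega>. norm (case (t, \<omega>) of (t, \<omega>) \<Rightarrow> (B j t \<omega>)\<^sup>2) \<partial>M)"
      using covariance[OF j j]
      by (subst Bochner_Integration.integrable_cong[OF refl, where g = "\<lambda>t. t"])
        (auto simp: space_unit_interval power2_eq_square)
    show "AE t in unit_interval. integrable M (\<lambda>\<omega>. case (t, \<omega>) of (t, \<omega>) \<Rightarrow> (B j t \<omega>)\<^sup>2)"
      using square_integrable[OF j] by (intro AE_I2) (auto simp: space_unit_interval)
  qed
  from UM.integrable_product_swap[OF this] show ?thesis
    by (simp add: case_prod_beta')
qed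

lemma integrable_energy: "1 \<le> j \<Longrightarrow> integrable M (energy j)"
  using MU.integrable_fst'[OF integrable_square, of j] by (simp add: energy_def[abs_def])

lemma expectation_energy:
  assumes j: "1 \<le> j"
  shows "expectation (energy j) = 1 / 2"
proof -
  have "expectation (energy j) = (\<integral>t. expectation (\<lambda>\<omega>. (B j t \<omega>)\<^sup>2) \<partial>unit_interval)"
    unfolding energy_def using MU.Fubini_integral[OF integrable_square[OF j]] by simp
  also have "\<dots> = (\<integral>t. t \<partial>unit_interval)"
    using covariance[OF j j]
    by (intro Bochner_Integration.integral_cong refl) (auto simp: space_unit_interval power2_eq_square)
  also have "\<dots> = 1 / 2"
    by (subst integral_unit_interval_FTC[where F = "\<lambda>t. t\<^sup>2 / 2"])
      (auto intro!: derivative_eq_intros continuous_intros)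
  finally show ?thesis .
qed

context
  fixes j :: nat and f :: "real \<Rightarrow> real"
  assumes j: "1 \<le> j" and f: "continuous_on {0..1} f"
begin

lemma jointly_measurable_mult:
  "(\<lambda>(\<omega>, t). B j t \<omega> * f t) \<in> borel_measurable (M \<Otimes>\<^sub>M unit_interval)"
proof -
  note [measurable] = jointly_measurable[OF j] borel_measurable_unit_interval[OF f]
  have "(\<lambda>x. (case x of (\<omega>, t) \<Rightarrow> B j t \<omega>) * f (snd x)) \<in> borel_measurable (M \<Otimes>\<^sub>M unit_interval)"
    by measurable
  then show ?thesis by (simp add: case_prod_beta')
qed

lemma coef_measurable: "coef j f \<in> borel_measurable M"
  unfolding coef_def[abs_def]
  using jointly_measurable_mult by (intro U.borel_measurable_lebesgue_integral)

lemma square_bounded: "\<exists>C\<ge>0. \<forall>t\<in>{0..1}. (f t)\<^sup>2 \<le> C"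
proof -
  have "compact ((\<lambda>t. (f t)\<^sup>2) ` {0..1})"
    by (intro compact_continuous_image continuous_intros f) auto
  then have "bounded ((\<lambda>t. (f t)\<^sup>2) ` {0..1})"
    by (rule compact_imp_bounded)
  then obtain C where C: "\<forall>t\<in>{0..1}. \<bar>(f t)\<^sup>2\<bar> \<le> C"
    by (auto simp: bounded_iff simp del: abs_power2)
  then have "0 \<le> C" by (intro order_trans[OF abs_ge_zero, of "(f 0)\<^sup>2"]) auto
  with C show ?thesis by auto
qed

lemma integrable_square_mult:
  "integrable (M \<Otimes>\<^sub>M unit_interval) (\<lambda>(\<omega>, t). (B j t \<omega> * f t)\<^sup>2)"
proof -
  obtain C where C: "0 \<le> C" "\<And>t. t \<in> {0..1} \<Longrightarrow> (f t)\<^sup>2 \<le> C"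
    using square_bounded by blast
  show ?thesis
  proof (rule Bochner_Integration.integrable_bound)
    show "integrable (M \<Otimes>\<^sub>M unit_interval) (\<lambda>x. C * (case x of (\<omega>, t) \<Rightarrow> (B j t \<omega>)\<^sup>2))"
      using integrable_square[OF j] by simp
    show "(\<lambda>(\<omega>, t). (B j t \<omega> * f t)\<^sup>2) \<in> borel_measurable (M \<Otimes>\<^sub>M unit_interval)"
      using borel_measurable_power[OF jointly_measurable_mult, of 2] by (simp add: case_prod_beta')
    show "AE x in M \<Otimes>\<^sub>M unit_interval. norm (case x of (\<omega>, t) \<Rightarrow> (B j t \<omega> * f t)\<^sup>2)
        \<le> norm (C * (case x of (\<omega>, t) \<Rightarrow> (B j t \<omega>)\<^sup>2))"
      using C by (intro AE_I2)
        (auto simp: space_pair_measure space_unit_interval power_mult_distrib mult.commute[of C] intro!: mult_left_mono)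
  qed
qed

text \<open>The square of an average over [0,1] is at most the average of the square; this is the
  nonnegativity of a variance on the unit interval.\<close>

lemma integrable_coef_square: "integrable M (\<lambda>\<omega>. (coef j f \<omega>)\<^sup>2)"
proof (rule Bochner_Integration.integrable_bound)
  show "integrable M (\<lambda>\<omega>. \<integral>t. (B j t \<omega> * f t)\<^sup>2 \<partial>unit_interval)"
    using MU.integrable_fst'[OF integrable_square_mult] by simp
  show "(\<lambda>\<omega>. (coef j f \<omega>)\<^sup>2) \<in> borel_measurable M"
    using coef_measurable by measurable
  have "(coef j f \<omega>)\<^sup>2 \<le> (\<integral>t. (B j t \<omega> * f t)\<^sup>2 \<partial>unit_interval)" for \<omega>
  proof -
    let ?h = "\<lambda>t. B j t \<omega> * f t"
    have h: "continuous_on {0..1} ?h"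
      by (intro continuous_intros continuous_paths f j)
    have "0 \<le> U.variance ?h"
      by (rule U.variance_positive)
    also have "\<dots> = U.expectation (\<lambda>t. (?h t)\<^sup>2) - (U.expectation ?h)\<^sup>2"
      using continuous_on_power[OF h, of 2] h by (intro U.variance_eq integrable_unit_interval)
    finally show ?thesis by (simp add: coef_def)
  qed
  then show "AE \<omega> in M. norm ((coef j f \<omega>)\<^sup>2) \<le> norm (\<integral>t. (B j t \<omega> * f t)\<^sup>2 \<partial>unit_interval)"
    by (intro AE_I2) (simp add: order_trans[OF _ abs_ge_self])
qed

lemma integrable_mult_mult:
  assumes Y: "Y \<in> borel_measurable M" "integrable M (\<lambda>\<omega>. (Y \<omega>)\<^sup>2)"
  shows "integrable (M \<Otimes>\<^sub>M unit_interval) (\<lambda>(\<omega>, t). Y \<omega> * (B j t \<omega> * f t))"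
proof -
  note [measurable] = Y(1)
  have "integrable (M \<Otimes>\<^sub>M unit_interval) (\<lambda>x. Y (fst x) * (case x of (\<omega>, t) \<Rightarrow> B j t \<omega> * f t))"
  proof (rule square_integrable_mult)
    show "integrable (M \<Otimes>\<^sub>M unit_interval) (\<lambda>x. (Y (fst x))\<^sup>2)"
      using Y(2) U.prob_space by (intro MU.Fubini_integrable) auto
    show "integrable (M \<Otimes>\<^sub>M unit_interval) (\<lambda>x. (case x of (\<omega>, t) \<Rightarrow> B j t \<omega> * f t)\<^sup>2)"
      using integrable_square_mult by (simp add: case_prod_beta')
  qed (use jointly_measurable_mult in simp_all)
  then show ?thesis by (simp add: case_prod_beta')
qed

text \<open>Fubini with a general square-integrable factor Y, so that it can be applied twice to a
  product of two coefficients: once with Y the other coefficient, and then with Y the path value at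
  a fixed time.\<close>

lemma expectation_mult_coef:
  assumes Y: "Y \<in> borel_measurable M" "integrable M (\<lambda>\<omega>. (Y \<omega>)\<^sup>2)"
  shows "expectation (\<lambda>\<omega>. Y \<omega> * coef j f \<omega>) = (\<integral>t. expectation (\<lambda>\<omega>. Y \<omega> * B j t \<omega>) * f t \<partial>unit_interval)"
proof -
  have "expectation (\<lambda>\<omega>. Y \<omega> * coef j f \<omega>) = expectation (\<lambda>\<omega>. \<integral>t. Y \<omega> * (B j t \<omega> * f t) \<partial>unit_interval)"
    by (simp add: coef_def)
  also have "\<dots> = (\<integral>t. expectation (\<lambda>\<omega>. Y \<omega> * (B j t \<omega> * f t)) \<partial>unit_interval)"
    using MU.Fubini_integral[OF integrable_mult_mult[OF Y]] by simp
  finally show ?thesis by (simp add: mult.assoc[symmetric])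
qed

end

lemma expectation_coef_coef:
  assumes "1 \<le> j" "1 \<le> l" "continuous_on {0..1} f" "continuous_on {0..1} g"
  shows "expectation (\<lambda>\<omega>. coef j f \<omega> * coef l g \<omega>)
    = of_bool (j = l) * (\<integral>t. f t * (\<integral>s. min t s * g s \<partial>unit_interval) \<partial>unit_interval)"
proof -
  have "expectation (\<lambda>\<omega>. coef j f \<omega> * coef l g \<omega>) = expectation (\<lambda>\<omega>. coef l g \<omega> * coef j f \<omega>)"
    by (simp add: mult.commute)
  also have "\<dots> = (\<integral>t. expectation (\<lambda>\<omega>. coef l g \<omega> * B j t \<omega>) * f t \<partial>unit_interval)"
    using assms by (intro expectation_mult_coef coef_measurable integrable_coef_square)
  also have "\<dots> = (\<integral>t. of_bool (j = l) * (f t * (\<integral>s. min t s * g s \<partial>unit_interval)) \<partial>unit_interval)"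
  proof (intro Bochner_Integration.integral_cong refl)
    fix t assume "t \<in> space unit_interval"
    then have t: "t \<in> {0..1}" by (simp add: space_unit_interval)
    have "expectation (\<lambda>\<omega>. coef l g \<omega> * B j t \<omega>) = expectation (\<lambda>\<omega>. B j t \<omega> * coef l g \<omega>)"
      by (simp add: mult.commute)
    also have "\<dots> = (\<integral>s. expectation (\<lambda>\<omega>. B j t \<omega> * B l s \<omega>) * g s \<partial>unit_interval)"
      using assms t by (intro expectation_mult_coef slice_measurable square_integrable)
    also have "\<dots> = (\<integral>s. of_bool (j = l) * (min t s * g s) \<partial>unit_interval)"
      using assms t covariance[of j l t]
      by (intro Bochner_Integration.integral_cong refl) (simp add: space_unit_interval)
    finally show "expectation (\<lambda>\<omega>. coef l g \<omega> * B j t \<omega>) * f t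
        = of_bool (j = l) * (f t * (\<integral>s. min t s * g s \<partial>unit_interval))"
      by simp
  qed
  finally show ?thesis by simp
qed

lemma expectation_coef_one:
  "1 \<le> j \<Longrightarrow> 1 \<le> l \<Longrightarrow> expectation (\<lambda>\<omega>. coef j (\<lambda>_. 1) \<omega> * coef l (\<lambda>_. 1) \<omega>) = of_bool (j = l) / 3"
  using expectation_coef_coef[of j l "\<lambda>_. 1" "\<lambda>_. 1"] min_kernel_1 by simp

lemma expectation_coef_cosine:
  "1 \<le> j \<Longrightarrow> 1 \<le> l \<Longrightarrow> 1 \<le> k \<Longrightarrow> 1 \<le> m \<Longrightarrow>
    expectation (\<lambda>\<omega>. coef j (cosine k) \<omega> * coef l (cosine m) \<omega>) = of_bool ((j, k) = (l, m)) * eigval k"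
  using expectation_coef_coef[of j l "cosine k" "cosine m"] min_kernel_cosine[of k m]
  by (simp add: continuous_on_cosine)

lemma integrable_coef_coef:
  "1 \<le> j \<Longrightarrow> 1 \<le> l \<Longrightarrow> continuous_on {0..1} f \<Longrightarrow> continuous_on {0..1} g \<Longrightarrow>
    integrable M (\<lambda>\<omega>. coef j f \<omega> * coef l g \<omega>)"
  by (intro square_integrable_mult coef_measurable integrable_coef_square)

end

section \<open>Second moments of a standard Wiener process\<close>

context
  fixes M :: "'a measure" and W :: "real \<Rightarrow> 'a \<Rightarrow> real"
  assumes W: "standard_Wiener M W"
begin

interpretation prob_space M
  using W by (simp add: standard_Wiener_def)

lemma standard_Wiener_measurable: "t \<in> {0..1} \<Longrightarrow> W t \<in> borel_measurable M"
  using W by (simp add: standard_Wiener_def)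

lemma standard_Wiener_increment:
  assumes "0 \<le> s" "s < t" "t \<le> 1"
  shows "integrable M (\<lambda>\<omega>. (W t \<omega> - W s \<omega>)\<^sup>2)" "expectation (\<lambda>\<omega>. (W t \<omega> - W s \<omega>)\<^sup>2) = t - s"
proof -
  have D: "distributed M lborel (\<lambda>\<omega>. W t \<omega> - W s \<omega>) (normal_density 0 (sqrt (t - s)))"
    using W assms by (simp add: standard_Wiener_def)
  have pos: "0 < sqrt (t - s)" using assms by simp
  show "integrable M (\<lambda>\<omega>. (W t \<omega> - W s \<omega>)\<^sup>2)"
    using distributed_integrable[OF D, of "\<lambda>x. x\<^sup>2"] integrable_normal_moment[OF pos, of 0 2] by simp
  show "expectation (\<lambda>\<omega>. (W t \<omega> - W s \<omega>)\<^sup>2) = t - s"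
    using normal_distributed_variance[OF pos D] normal_distributed_expectation[OF pos D] assms by simp
qed

lemma standard_Wiener_square:
  assumes t: "t \<in> {0..1}"
  shows "integrable M (\<lambda>\<omega>. (W t \<omega>)\<^sup>2)" "expectation (\<lambda>\<omega>. (W t \<omega>)\<^sup>2) = t"
proof -
  have W0: "AE \<omega> in M. W 0 \<omega> = 0"
    using W by (simp add: standard_Wiener_def)
  note [measurable] = standard_Wiener_measurable[OF t] standard_Wiener_measurable[of 0, simplified]
  have eq: "AE \<omega> in M. (W t \<omega>)\<^sup>2 = (W t \<omega> - W 0 \<omega>)\<^sup>2"
    using W0 by eventually_elim simp
  \<comment> \<open>The law of increments is given for s < t, so t = 0 is separate; there the
    increment is identically 0.\<close>
  have "integrable M (\<lambda>\<omega>. (W t \<omega> - W 0 \<omega>)\<^sup>2) \<and> expectation (\<lambda>\<omega>. (W t \<omega> - W 0 \<omega>)\<^sup>2) = t"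
    using standard_Wiener_increment[of 0 t] t by (cases "t = 0") auto
  moreover have "integrable M (\<lambda>\<omega>. (W t \<omega>)\<^sup>2) \<longleftrightarrow> integrable M (\<lambda>\<omega>. (W t \<omega> - W 0 \<omega>)\<^sup>2)"
    using eq by (intro integrable_cong_AE) auto
  moreover have "expectation (\<lambda>\<omega>. (W t \<omega>)\<^sup>2) = expectation (\<lambda>\<omega>. (W t \<omega> - W 0 \<omega>)\<^sup>2)"
    using eq by (intro integral_cong_AE) auto
  ultimately show "integrable M (\<lambda>\<omega>. (W t \<omega>)\<^sup>2)" "expectation (\<lambda>\<omega>. (W t \<omega>)\<^sup>2) = t"
    by auto
qed

text \<open>Polarisation: for s < t, expanding the second moment t - s of the increment gives t + s
  minus twice the covariance.\<close>

lemma standard_Wiener_covariance: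
  assumes t: "t \<in> {0..1}" and s: "s \<in> {0..1}"
  shows "expectation (\<lambda>\<omega>. W t \<omega> * W s \<omega>) = min t s"
proof -
  have *: "expectation (\<lambda>\<omega>. W t \<omega> * W s \<omega>) = s" if t: "t \<in> {0..1}" and s: "s \<in> {0..1}" and st: "s < t" for s t
  proof -
    note int = standard_Wiener_square(1)[OF t] standard_Wiener_square(1)[OF s]
    have prod: "integrable M (\<lambda>\<omega>. W t \<omega> * W s \<omega>)"
      using t s by (intro square_integrable_mult standard_Wiener_measurable int)
    have "t - s = expectation (\<lambda>\<omega>. (W t \<omega> - W s \<omega>)\<^sup>2)"
      using standard_Wiener_increment(2)[of s t] t s st by simp
    also have "\<dots> = expectation (\<lambda>\<omega>. ((W t \<omega>)\<^sup>2 + (W s \<omega>)\<^sup>2) - 2 * (W t \<omega> * W s \<omega>))"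
      by (simp add: power2_diff mult.assoc)
    also have "\<dots> = t + s - 2 * expectation (\<lambda>\<omega>. W t \<omega> * W s \<omega>)"
      using int prod standard_Wiener_square(2)[OF t] standard_Wiener_square(2)[OF s] by simp
    finally show ?thesis by simp
  qed
  consider "s < t" | "t < s" | "s = t" by linarith
  then show ?thesis
  proof cases
    case 1 with * t s show ?thesis by simp
  next
    case 2 with *[OF s t] show ?thesis by (simp add: mult.commute)
  next
    case 3 with standard_Wiener_square(2)[OF t] show ?thesis by (simp add: power2_eq_square)
  qed
qed

end

text \<open>Rounding the time down to the grid of mesh 1/(n+1) leaves countably many time values, so
  each approximant is jointly measurable, and path continuity gives convergence. The countable
  family runs through all multiples of the mesh, also those beyond 1; hence measurability is asked
  for every real t.\<close>

lemma measurable_Pair_continuous: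
  fixes B :: "real \<Rightarrow> 'a \<Rightarrow> real"
  assumes [measurable]: "\<And>t. B t \<in> borel_measurable M"
    and cont: "\<And>\<omega>. \<omega> \<in> space M \<Longrightarrow> continuous_on {0..1} (\<lambda>t. B t \<omega>)"
  shows "(\<lambda>(\<omega>, t). B t \<omega>) \<in> borel_measurable (M \<Otimes>\<^sub>M unit_interval)"
proof (rule borel_measurable_LIMSEQ_real)
  let ?a = "\<lambda>n t. real (nat \<lfloor>real (Suc n) * t\<rfloor>) / real (Suc n)"
  have id[measurable]: "(\<lambda>t. t) \<in> borel_measurable unit_interval"
    by (intro borel_measurable_unit_interval continuous_intros)
  show "(\<lambda>x. B (?a n (snd x)) (fst x)) \<in> borel_measurable (M \<Otimes>\<^sub>M unit_interval)" for n
    by (rule measurable_compose_countable[where f = "\<lambda>i x. B (real i / real (Suc n)) (fst x)"]) measurable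
  fix x assume x: "x \<in> space (M \<Otimes>\<^sub>M unit_interval)"
  then have \<omega>: "fst x \<in> space M" and t: "0 \<le> snd x" "snd x \<le> 1"
    by (auto simp: space_pair_measure space_unit_interval)
  have near: "snd x - 1 / real (Suc n) \<le> ?a n (snd x) \<and> ?a n (snd x) \<le> snd x" for n
  proof -
    let ?y = "real (Suc n) * snd x"
    have y: "?y - 1 \<le> real (nat \<lfloor>?y\<rfloor>)" "real (nat \<lfloor>?y\<rfloor>) \<le> ?y"
      using of_nat_floor[of ?y] t by (linarith, simp)
    have "snd x - 1 / real (Suc n) = (?y - 1) / real (Suc n)" "?y / real (Suc n) = snd x"
      by (simp_all add: diff_divide_distrib del: of_nat_Suc)
    then show ?thesis
      using divide_right_mono[OF y(1), of "real (Suc n)"] divide_right_mono[OF y(2), of "real (Suc n)"] by simp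
  qed
  have "(\<lambda>n. ?a n (snd x)) \<longlonglongrightarrow> snd x"
  proof (rule tendsto_sandwich)
    show "(\<lambda>n. snd x - 1 / real (Suc n)) \<longlonglongrightarrow> snd x"
      using tendsto_diff[OF tendsto_const LIMSEQ_inverse_real_of_nat, of "snd x"] by (simp add: field_simps)
  qed (use near in auto)
  moreover have "?a n (snd x) \<in> {0..1}" for n
  proof -
    have "0 \<le> ?a n (snd x)" by simp
    with near[of n] t show ?thesis unfolding atLeastAtMost_iff by linarith
  qed
  ultimately show "(\<lambda>n. B (?a n (snd x)) (fst x)) \<longlonglongrightarrow> (case x of (\<omega>, t) \<Rightarrow> B t \<omega>)"
    using t by (auto simp: case_prod_beta' intro!: continuous_on_tendsto_compose[OF cont[OF \<omega>]])
qed

lemma exists_continuous_wiener_family: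
  fixes W :: "nat \<Rightarrow> real \<Rightarrow> 'a \<Rightarrow> real"
  assumes "prob_space M"
    and W: "\<And>j. j \<ge> 1 \<Longrightarrow> standard_Wiener M (W j)"
    and uncor: "uncorrelated_processes M {1..} W"
  shows "\<exists>B. continuous_wiener_family M B \<and> (AE \<omega> in M. \<forall>j\<ge>1. \<forall>t\<in>{0..1}. B j t \<omega> = W j t \<omega>)"
proof -
  interpret prob_space M by fact
  have "AE \<omega> in M. \<forall>j. 1 \<le> j \<longrightarrow> continuous_on {0..1} (\<lambda>t. W j t \<omega>)"
    using W by (auto simp: AE_all_countable standard_Wiener_def)
  \<comment> \<open>The set of discontinuous paths may fail to be measurable, so it is enclosed in a
    measurable null set, common to the countably many j.\<close>
  then obtain N where N: "N \<in> sets M" "emeasure M N = 0"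
    and contN: "{\<omega> \<in> space M. \<not> (\<forall>j. 1 \<le> j \<longrightarrow> continuous_on {0..1} (\<lambda>t. W j t \<omega>))} \<subseteq> N"
    by (auto elim: AE_E)
  let ?G = "space M - N"
  \<comment> \<open>Clamping the time makes \<open>B j t\<close> measurable for every real t, as
    joint measurability requires, and changes nothing on [0,1].\<close>
  let ?c = "\<lambda>t::real. max 0 (min 1 t)"
  define B where "B j t \<omega> = indicator ?G \<omega> * W j (?c t) \<omega>" for j t \<omega>
  have c: "?c t \<in> {0..1}" for t by auto
  have c_id: "?c t = t" if "t \<in> {0..1}" for t using that by auto
  have AE_G: "AE \<omega> in M. \<omega> \<in> ?G"
    using AE_not_in[of N M] AE_space N by (auto simp: null_sets_def)
  have AE_B: "AE \<omega> in M. \<forall>j\<ge>1. \<forall>t\<in>{0..1}. B j t \<omega> = W j t \<omega>"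
    using AE_G by eventually_elim (auto simp: B_def)
  have meas: "B j t \<in> borel_measurable M" if "1 \<le> j" for j t
    unfolding B_def using N standard_Wiener_measurable[OF W[OF that] c]
    by (intro borel_measurable_times borel_measurable_indicator) auto
  have cont: "continuous_on {0..1} (\<lambda>t. B j t \<omega>)" if "1 \<le> j" for j \<omega>
  proof (cases "\<omega> \<in> ?G")
    case True
    with that contN have "continuous_on {0..1} (\<lambda>t. W j t \<omega>)" by auto
    then show ?thesis
      by (rule continuous_on_eq) (use True in \<open>auto simp: B_def\<close>)
  qed (simp add: B_def)
  have B_W: "AE \<omega> in M. B j t \<omega> = W j t \<omega>" if "1 \<le> j" "t \<in> {0..1}" for j t
    using AE_B by eventually_elim (use that in auto)
  have "continuous_wiener_family M B"
  proof
    fix j :: nat and \<omega> assume j: "1 \<le> j"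
    show "continuous_on {0..1} (\<lambda>t. B j t \<omega>)" by (rule cont[OF j])
    show "(\<lambda>(\<omega>, t). B j t \<omega>) \<in> borel_measurable (M \<Otimes>\<^sub>M unit_interval)"
      by (intro measurable_Pair_continuous meas cont j)
  next
    fix j :: nat and t :: real assume j: "1 \<le> j" and t: "t \<in> {0..1}"
    have "integrable M (\<lambda>\<omega>. (B j t \<omega>)\<^sup>2) \<longleftrightarrow> integrable M (\<lambda>\<omega>. (W j t \<omega>)\<^sup>2)"
    proof (rule integrable_cong_AE)
      show "AE \<omega> in M. (B j t \<omega>)\<^sup>2 = (W j t \<omega>)\<^sup>2"
        using B_W[OF j t] by eventually_elim simp
    qed (use meas[OF j] standard_Wiener_measurable[OF W[OF j] t] in auto)
    then show "integrable M (\<lambda>\<omega>. (B j t \<omega>)\<^sup>2)"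
      using standard_Wiener_square(1)[OF W[OF j] t] by simp
  next
    fix j l :: nat and t s :: real
    assume jl: "1 \<le> j" "1 \<le> l" and ts: "t \<in> {0..1}" "s \<in> {0..1}"
    have "expectation (\<lambda>\<omega>. B j t \<omega> * B l s \<omega>) = expectation (\<lambda>\<omega>. W j t \<omega> * W l s \<omega>)"
    proof (rule integral_cong_AE)
      show "AE \<omega> in M. B j t \<omega> * B l s \<omega> = W j t \<omega> * W l s \<omega>"
        using B_W[OF jl(1) ts(1)] B_W[OF jl(2) ts(2)] by eventually_elim simp
    qed (use meas jl ts standard_Wiener_measurable[OF W] in auto)
    also have "\<dots> = of_bool (j = l) * min t s"
      using standard_Wiener_covariance[OF W[OF jl(1)] ts] uncor jl ts
      by (auto simp: uncorrelated_processes_def)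
    finally show "expectation (\<lambda>\<omega>. B j t \<omega> * B l s \<omega>) = of_bool (j = l) * min t s" .
  qed
  with AE_B show ?thesis by blast
qed

section \<open>The approximation error\<close>

lemma root_mean_square_cong_AE:
  assumes "AE \<omega> in M. \<forall>t\<in>space (cube d). U t \<omega> = V t \<omega>"
  shows "root_mean_square M d U = root_mean_square M d V"
proof -
  have "AE \<omega> in M. ennreal ((L2_norm d (\<lambda>t. U t \<omega>))\<^sup>2) = ennreal ((L2_norm d (\<lambda>t. V t \<omega>))\<^sup>2)"
    using assms
  proof eventually_elim
    case (elim \<omega>)
    then have "L2_norm d (\<lambda>t. U t \<omega>) = L2_norm d (\<lambda>t. V t \<omega>)"
      unfolding L2_norm_def L2_inner_def
      by (intro arg_cong[where f = sqrt] Bochner_Integration.integral_cong) auto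
    then show ?case by simp
  qed
  then have "(\<integral>\<^sup>+\<omega>. ennreal ((L2_norm d (\<lambda>t. U t \<omega>))\<^sup>2) \<partial>M) = (\<integral>\<^sup>+\<omega>. ennreal ((L2_norm d (\<lambda>t. V t \<omega>))\<^sup>2) \<partial>M)"
    by (rule nn_integral_cong_AE)
  then show ?thesis by (simp add: root_mean_square_def)
qed

text \<open>Outside one null set the paths agree, hence so do their coefficients, for every \<psi>
  simultaneously. The infimum is thus taken over the same set of numbers, which lets the continuous
  version replace the given processes.\<close>

lemma approx_error_cong_AE:
  assumes "AE \<omega> in M. \<forall>t\<in>space (cube d). U t \<omega> = V t \<omega>"
  shows "approx_error M d U n = approx_error M d V n"
proof -
  have "root_mean_square M d (\<lambda>t \<omega>. U t \<omega> - (\<Sum>m=1..n. L2_inner d (\<lambda>u. U u \<omega>) (\<psi> m) * \<psi> m t))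
      = root_mean_square M d (\<lambda>t \<omega>. V t \<omega> - (\<Sum>m=1..n. L2_inner d (\<lambda>u. V u \<omega>) (\<psi> m) * \<psi> m t))" for \<psi>
  proof (rule root_mean_square_cong_AE)
    show "AE \<omega> in M. \<forall>t\<in>space (cube d). U t \<omega> - (\<Sum>m=1..n. L2_inner d (\<lambda>u. U u \<omega>) (\<psi> m) * \<psi> m t)
      = V t \<omega> - (\<Sum>m=1..n. L2_inner d (\<lambda>u. V u \<omega>) (\<psi> m) * \<psi> m t)"
      using assms
    proof eventually_elim
      case (elim \<omega>)
      then have "L2_inner d (\<lambda>u. U u \<omega>) (\<psi> m) = L2_inner d (\<lambda>u. V u \<omega>) (\<psi> m)" for m
        unfolding L2_inner_def by (intro Bochner_Integration.integral_cong) auto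
      with elim show ?case by simp
    qed
  qed
  then show ?thesis
    using root_mean_square_cong_AE[OF assms] by (simp add: approx_error_def)
qed

lemma approx_error_le:
  assumes "\<And>m. m \<in> {1..n} \<Longrightarrow> \<psi> m \<in> L2_space d" "n \<noteq> 0"
  shows "approx_error M d V n
    \<le> root_mean_square M d (\<lambda>t \<omega>. V t \<omega> - (\<Sum>m=1..n. L2_inner d (\<lambda>u. V u \<omega>) (\<psi> m) * \<psi> m t))"
proof -
  have "Inf {root_mean_square M d (\<lambda>t \<omega>. V t \<omega> - (\<Sum>m=1..n. L2_inner d (\<lambda>u. V u \<omega>) (\<psi> m) * \<psi> m t))
               | \<psi>. \<forall>m\<in>{1..n}. \<psi> m \<in> L2_space d}
    \<le> root_mean_square M d (\<lambda>t \<omega>. V t \<omega> - (\<Sum>m=1..n. L2_inner d (\<lambda>u. V u \<omega>) (\<psi> m) * \<psi> m t))"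
    using assms by (intro cInf_lower bdd_belowI[of _ 0]) (auto simp: root_mean_square_def)
  then show ?thesis using assms(2) by (simp add: approx_error_def)
qed

lemma approx_error_ge:
  assumes "\<And>\<psi>. (\<And>m. m \<in> {1..n} \<Longrightarrow> \<psi> m \<in> L2_space d) \<Longrightarrow>
      c \<le> root_mean_square M d (\<lambda>t \<omega>. V t \<omega> - (\<Sum>m=1..n. L2_inner d (\<lambda>u. V u \<omega>) (\<psi> m) * \<psi> m t))"
    and "n \<noteq> 0"
  shows "c \<le> approx_error M d V n"
proof -
  have "c \<le> Inf {root_mean_square M d (\<lambda>t \<omega>. V t \<omega> - (\<Sum>m=1..n. L2_inner d (\<lambda>u. V u \<omega>) (\<psi> m) * \<psi> m t))
               | \<psi>. \<forall>m\<in>{1..n}. \<psi> m \<in> L2_space d}"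
  proof (rule cInf_greatest)
    have "(\<lambda>_. 0) \<in> L2_space d" by (rule L2_space_zero)
    then show "{root_mean_square M d (\<lambda>t \<omega>. V t \<omega> - (\<Sum>m=1..n. L2_inner d (\<lambda>u. V u \<omega>) (\<psi> m) * \<psi> m t))
               | \<psi>. \<forall>m\<in>{1..n}. \<psi> m \<in> L2_space d} \<noteq> {}"
      by (auto intro!: exI[of _ "\<lambda>_ _. 0"])
  qed (use assms(1) in auto)
  then show ?thesis using assms(2) by (simp add: approx_error_def)
qed

text \<open>For general \<psi> the residual map is no contraction, but a crude constant suffices:
  the bound serves to make the expected residual finite, as \<open>enn2real\<close> would turn an
  infinite value into 0 and spoil the lower bound. Cauchy-Schwarz is applied twice, in the function
  space for the coefficients and pointwise for the finite sum.\<close>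

lemma L2_residual_bound:
  assumes v: "v \<in> L2_space d" and \<psi>: "\<And>m. m \<in> I \<Longrightarrow> \<psi> m \<in> L2_space d"
  defines "r \<equiv> (\<lambda>t. v t - (\<Sum>m\<in>I. L2_inner d v (\<psi> m) * \<psi> m t))"
  shows "L2_inner d r r \<le> (2 + 2 * (\<Sum>m\<in>I. L2_inner d (\<psi> m) (\<psi> m))\<^sup>2) * L2_inner d v v"
proof -
  let ?c = "\<lambda>m. L2_inner d v (\<psi> m)"
  let ?S = "\<Sum>m\<in>I. L2_inner d (\<psi> m) (\<psi> m)"
  let ?C = "\<Sum>m\<in>I. (?c m)\<^sup>2"
  have r: "r \<in> L2_space d"
    unfolding r_def by (intro L2_space_diff L2_space_sum L2_space_cmult v \<psi>)
  have C: "?C \<le> L2_inner d v v * ?S"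
    unfolding sum_distrib_left by (intro sum_mono L2_Cauchy_Schwarz v \<psi>)
  have int: "integrable (cube d) (\<lambda>t. (f t)\<^sup>2)" if "f \<in> L2_space d" for f
    using that by (simp add: L2_space_def)
  have "(r t)\<^sup>2 \<le> 2 * (v t)\<^sup>2 + 2 * (?C * (\<Sum>m\<in>I. (\<psi> m t)\<^sup>2))" for t
  proof -
    have "(a - b)\<^sup>2 \<le> 2 * a\<^sup>2 + 2 * b\<^sup>2" for a b :: real
      using zero_le_power2[of "a + b"] by (simp add: power2_sum power2_diff)
    then have "(r t)\<^sup>2 \<le> 2 * (v t)\<^sup>2 + 2 * (\<Sum>m\<in>I. ?c m * \<psi> m t)\<^sup>2"
      by (simp add: r_def)
    also have "(\<Sum>m\<in>I. ?c m * \<psi> m t)\<^sup>2 \<le> ?C * (\<Sum>m\<in>I. (\<psi> m t)\<^sup>2)"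
      by (rule Cauchy_Schwarz_ineq_sum)
    finally show ?thesis by simp
  qed
  then have "L2_inner d r r \<le> (\<integral>t. 2 * (v t)\<^sup>2 + 2 * (?C * (\<Sum>m\<in>I. (\<psi> m t)\<^sup>2)) \<partial>cube d)"
    unfolding L2_inner_def power2_eq_square[symmetric] using r v \<psi>
    by (intro integral_mono) (auto intro!: int Bochner_Integration.integrable_add integrable_mult_right Bochner_Integration.integrable_sum)
  also have "\<dots> = 2 * L2_inner d v v + 2 * (?C * ?S)"
    using v \<psi> by (simp add: int L2_inner_def power2_eq_square[symmetric] Bochner_Integration.integral_sum)
  also have "\<dots> \<le> 2 * L2_inner d v v + 2 * (L2_inner d v v * ?S * ?S)"
    using C by (intro add_left_mono mult_left_mono mult_right_mono sum_nonneg L2_inner_nonneg) auto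
  finally show ?thesis
    by (simp add: algebra_simps power2_eq_square)
qed

text \<open>The constant function is common to all coordinates and must occur once in an orthonormal
  system. Index pairs with k = 0 would list it d times; the \<open>option\<close> type gives it the
  single index \<open>None\<close>.\<close>

definition coord_basis :: "(nat \<times> nat) option \<Rightarrow> (nat \<Rightarrow> real) \<Rightarrow> real" where
  "coord_basis i t = (case i of None \<Rightarrow> 1 | Some (j, k) \<Rightarrow> cosine k (t j))"

lemma coord_basis_simps [simp]:
  "coord_basis None = (\<lambda>t. 1)" "coord_basis (Some (j, k)) = (\<lambda>t. cosine k (t j))"
  by (auto simp: coord_basis_def)

lemma L2_space_continuous_component:
  "j \<in> {1..d} \<Longrightarrow> continuous_on {0..1} a \<Longrightarrow> (\<lambda>t. a (t j)) \<in> L2_space d"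
  by (intro L2_space_component borel_measurable_unit_interval integrable_unit_interval continuous_intros)

lemma L2_inner_continuous_component:
  assumes "j \<in> {1..d}" "l \<in> {1..d}" "continuous_on {0..1} a" "continuous_on {0..1} b"
  shows "L2_inner d (\<lambda>t. a (t j)) (\<lambda>t. b (t l)) =
    (if j = l then \<integral>s. a s * b s \<partial>unit_interval else integral\<^sup>L unit_interval a * integral\<^sup>L unit_interval b)"
  using assms by (auto intro!: L2_inner_component_same L2_inner_component_diff
      borel_measurable_unit_interval integrable_unit_interval)

lemma L2_space_one: "(\<lambda>t. 1) \<in> L2_space d"
proof -
  interpret prob_space "cube d" by (rule prob_space_cube)
  show ?thesis by (simp add: L2_space_def)
qed

lemma L2_inner_one_one: "L2_inner d (\<lambda>t. 1) (\<lambda>t. 1) = 1"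
proof -
  interpret prob_space "cube d" by (rule prob_space_cube)
  show ?thesis using prob_space by (simp add: L2_inner_def)
qed

lemma L2_inner_component_one:
  "j \<in> {1..d} \<Longrightarrow> continuous_on {0..1} a \<Longrightarrow> L2_inner d (\<lambda>t. a (t j)) (\<lambda>t. 1) = integral\<^sup>L unit_interval a"
  by (simp add: L2_inner_def integral_cube_component borel_measurable_unit_interval)

lemma coord_basis_L2:
  assumes "i \<in> insert None (Some ` ({1..d} \<times> {1..}))"
  shows "coord_basis i \<in> L2_space d"
proof (cases i)
  case (Some p)
  with assms obtain j k where "p = (j, k)" "j \<in> {1..d}" by auto
  then show ?thesis
    using L2_space_continuous_component[of j d "cosine k"] Some by (simp add: continuous_on_cosine)
qed (simp add: L2_space_one)

text \<open>Cosines in different coordinates have an inner product equal to the product of their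
  means, and each cosine has mean 0. The same fact gives orthogonality to the constant.\<close>

lemma coord_basis_orthonormal:
  assumes i: "i \<in> insert None (Some ` ({1..d} \<times> {1..}))" and i': "i' \<in> insert None (Some ` ({1..d} \<times> {1..}))"
  shows "L2_inner d (coord_basis i) (coord_basis i') = of_bool (i = i')"
proof -
  have one: "L2_inner d (coord_basis (Some p)) (\<lambda>t. 1) = 0" if "p \<in> {1..d} \<times> {1..}" for p
  proof -
    obtain j k where "p = (j, k)" "j \<in> {1..d}" "0 < k" using \<open>p \<in> {1..d} \<times> {1..}\<close> by auto
    then show ?thesis
      using L2_inner_component_one[of j d "cosine k"] by (simp add: continuous_on_cosine integral_cosine)
  qed
  show ?thesis
  proof (cases i)
    case None
    then show ?thesis
      using i' one L2_inner_one_one[of d] L2_inner_commute[of d "\<lambda>t. 1" "coord_basis i'"] by (cases i') auto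
  next
    case (Some p)
    show ?thesis
    proof (cases i')
      case None
      then show ?thesis using i one Some by auto
    next
      fix q assume q: "i' = Some q"
      from Some i obtain j k where p: "p = (j, k)" "j \<in> {1..d}" "0 < k" by auto
      from q i' obtain l m where q': "q = (l, m)" "l \<in> {1..d}" "0 < m" by auto
      show ?thesis
        using L2_inner_continuous_component[of j d l "cosine k" "cosine m"] p q' Some q
        by (simp add: continuous_on_cosine integral_cosine integral_cosine_cosine)
    qed
  qed
qed

lemma root_mean_square_eq:
  assumes "\<And>\<omega>. L2_inner d (\<lambda>t. V t \<omega>) (\<lambda>t. V t \<omega>) = R \<omega>" "integrable M R"
  shows "root_mean_square M d V = sqrt (integral\<^sup>L M R)"
proof -
  have nonneg: "0 \<le> R \<omega>" for \<omega>
    using L2_inner_nonneg[of d "\<lambda>t. V t \<omega>"] assms(1) by simp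
  have "(\<integral>\<^sup>+\<omega>. ennreal ((L2_norm d (\<lambda>t. V t \<omega>))\<^sup>2) \<partial>M) = ennreal (integral\<^sup>L M R)"
    unfolding L2_norm_power2 assms(1) using assms(2) nonneg by (intro nn_integral_eq_integral) auto
  then show ?thesis
    using nonneg by (simp add: root_mean_square_def integral_nonneg_AE)
qed

section \<open>The additive field: coefficients, norm and upper bound\<close>

context continuous_wiener_family
begin

abbreviation sample :: "nat \<Rightarrow> 'a \<Rightarrow> (nat \<Rightarrow> real) \<Rightarrow> real" where
  "sample d \<omega> \<equiv> (\<lambda>t. additive_field B d t \<omega>)"

lemma L2_space_path: "j \<in> {1..d} \<Longrightarrow> (\<lambda>t. B j (t j) \<omega>) \<in> L2_space d"
  using L2_space_continuous_component[of j d "\<lambda>s. B j s \<omega>"] continuous_paths[of j \<omega>] by simp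

lemma L2_space_field: "sample d \<omega> \<in> L2_space d"
  unfolding additive_field_def by (intro L2_space_sum L2_space_path)

lemma L2_inner_field:
  assumes "h \<in> L2_space d"
  shows "L2_inner d (sample d \<omega>) h = (\<Sum>j=1..d. L2_inner d (\<lambda>t. B j (t j) \<omega>) h)"
  using L2_inner_sum_left[of "{1..d}" "\<lambda>j t. B j (t j) \<omega>" d h "\<lambda>_. 1"] L2_space_path assms
  by (simp add: additive_field_def)

lemma integral_path: "integral\<^sup>L unit_interval (\<lambda>s. B j s \<omega>) = coef j (\<lambda>_. 1) \<omega>"
  by (simp add: coef_def)

lemma L2_inner_field_one: "L2_inner d (sample d \<omega>) (\<lambda>t. 1) = (\<Sum>j=1..d. coef j (\<lambda>_. 1) \<omega>)"
  using L2_inner_component_one[of _ d "\<lambda>s. B _ s \<omega>"] continuous_paths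
  by (simp add: L2_inner_field L2_space_one integral_path)

text \<open>The summands in other coordinates contribute the mean of their path times the mean of
  the cosine, which is 0.\<close>

lemma L2_inner_field_cosine:
  assumes j: "j \<in> {1..d}" and k: "1 \<le> k"
  shows "L2_inner d (sample d \<omega>) (\<lambda>t. cosine k (t j)) = coef j (cosine k) \<omega>"
proof -
  have "L2_inner d (sample d \<omega>) (\<lambda>t. cosine k (t j)) = (\<Sum>l=1..d. L2_inner d (\<lambda>t. B l (t l) \<omega>) (\<lambda>t. cosine k (t j)))"
    using j by (intro L2_inner_field L2_space_continuous_component continuous_on_cosine)
  also have "\<dots> = (\<Sum>l=1..d. if l = j then coef j (cosine k) \<omega> else 0)"
    using j k L2_inner_continuous_component[of _ d j "\<lambda>s. B _ s \<omega>" "cosine k"] continuous_paths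
    by (intro sum.cong refl) (auto simp: continuous_on_cosine integral_cosine coef_def)
  also have "\<dots> = coef j (cosine k) \<omega>"
    using j by simp
  finally show ?thesis .
qed

text \<open>Distinct coordinates contribute products of path means. Adding and subtracting the
  squared means on the diagonal completes the square: the first sum is the energy of the centred
  parts, the last term that of the common constant.\<close>

lemma L2_inner_field_field:
  "L2_inner d (sample d \<omega>) (sample d \<omega>)
    = (\<Sum>j=1..d. energy j \<omega> - (coef j (\<lambda>_. 1) \<omega>)\<^sup>2) + (\<Sum>j=1..d. coef j (\<lambda>_. 1) \<omega>)\<^sup>2"
proof -
  let ?c = "\<lambda>j. coef j (\<lambda>_. 1) \<omega>"
  have "L2_inner d (sample d \<omega>) (sample d \<omega>)
      = (\<Sum>j=1..d. \<Sum>l=1..d. L2_inner d (\<lambda>t. B l (t l) \<omega>) (\<lambda>t. B j (t j) \<omega>))"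
    unfolding L2_inner_field[OF L2_space_field]
    by (intro sum.cong refl, subst L2_inner_commute, rule L2_inner_field, rule L2_space_path)
  also have "\<dots> = (\<Sum>j=1..d. \<Sum>l=1..d. (if l = j then energy j \<omega> - (?c j)\<^sup>2 else 0) + ?c j * ?c l)"
  proof (intro sum.cong refl)
    fix j l assume jl: "j \<in> {1..d}" "l \<in> {1..d}"
    then show "L2_inner d (\<lambda>t. B l (t l) \<omega>) (\<lambda>t. B j (t j) \<omega>)
        = (if l = j then energy j \<omega> - (?c j)\<^sup>2 else 0) + ?c j * ?c l"
      using L2_inner_continuous_component[of l d j "\<lambda>s. B l s \<omega>" "\<lambda>s. B j s \<omega>"] continuous_paths
      by (simp add: integral_path energy_def power2_eq_square)
  qed
  also have "\<dots> = (\<Sum>j=1..d. energy j \<omega> - (?c j)\<^sup>2) + (\<Sum>j=1..d. ?c j)\<^sup>2"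
    by (simp add: sum.distrib power2_eq_square sum_product)
  finally show ?thesis .
qed

lemma expectation_centered_energy:
  "integrable M (\<lambda>\<omega>. \<Sum>j=1..d. energy j \<omega> - (coef j (\<lambda>_. 1) \<omega>)\<^sup>2)"
  "expectation (\<lambda>\<omega>. \<Sum>j=1..d. energy j \<omega> - (coef j (\<lambda>_. 1) \<omega>)\<^sup>2) = real d / 6"
proof -
  have int: "integrable M (\<lambda>\<omega>. energy j \<omega> - (coef j (\<lambda>_. 1) \<omega>)\<^sup>2)" if "j \<in> {1..d}" for j
    using that by (intro Bochner_Integration.integrable_diff integrable_energy integrable_coef_square) auto
  then show "integrable M (\<lambda>\<omega>. \<Sum>j=1..d. energy j \<omega> - (coef j (\<lambda>_. 1) \<omega>)\<^sup>2)"
    by (rule Bochner_Integration.integrable_sum)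
  have "expectation (\<lambda>\<omega>. energy j \<omega> - (coef j (\<lambda>_. 1) \<omega>)\<^sup>2) = 1 / 6" if "j \<in> {1..d}" for j
  proof -
    have j: "1 \<le> j" using that by simp
    have "expectation (\<lambda>\<omega>. energy j \<omega> - (coef j (\<lambda>_. 1) \<omega>)\<^sup>2)
        = expectation (energy j) - expectation (\<lambda>\<omega>. (coef j (\<lambda>_. 1) \<omega>)\<^sup>2)"
      using j by (intro Bochner_Integration.integral_diff integrable_energy integrable_coef_square) auto
    then show ?thesis
      using expectation_energy[OF j] expectation_coef_one[OF j j] by (simp add: power2_eq_square)
  qed
  note E = this
  have "expectation (\<lambda>\<omega>. \<Sum>j=1..d. energy j \<omega> - (coef j (\<lambda>_. 1) \<omega>)\<^sup>2)
      = (\<Sum>j=1..d. expectation (\<lambda>\<omega>. energy j \<omega> - (coef j (\<lambda>_. 1) \<omega>)\<^sup>2))"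
    using int by (rule Bochner_Integration.integral_sum)
  also have "\<dots> = (\<Sum>j=1..d. 1 / 6)"
    by (intro sum.cong refl E)
  finally show "expectation (\<lambda>\<omega>. \<Sum>j=1..d. energy j \<omega> - (coef j (\<lambda>_. 1) \<omega>)\<^sup>2) = real d / 6"
    by simp
qed

lemma expectation_field_square:
  "integrable M (\<lambda>\<omega>. L2_inner d (sample d \<omega>) (sample d \<omega>))"
  "expectation (\<lambda>\<omega>. L2_inner d (sample d \<omega>) (sample d \<omega>)) = real d / 2"
proof -
  have int: "integrable M (\<lambda>\<omega>. coef j (\<lambda>_. 1) \<omega> * coef l (\<lambda>_. 1) \<omega>)" if "j \<in> {1..d}" "l \<in> {1..d}" for j l
    using that by (intro integrable_coef_coef) auto
  have sq: "(\<Sum>j=1..d. coef j (\<lambda>_. 1) \<omega>)\<^sup>2 = (\<Sum>j=1..d. \<Sum>l=1..d. coef j (\<lambda>_. 1) \<omega> * coef l (\<lambda>_. 1) \<omega>)" for \<omega>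
    by (simp add: power2_eq_square sum_product)
  have int2: "integrable M (\<lambda>\<omega>. (\<Sum>j=1..d. coef j (\<lambda>_. 1) \<omega>)\<^sup>2)"
    unfolding sq by (intro Bochner_Integration.integrable_sum int)
  \<comment> \<open>Here the processes being uncorrelated enters: the off-diagonal terms vanish, and
    d variances 1/3 remain.\<close>
  have "expectation (\<lambda>\<omega>. (\<Sum>j=1..d. coef j (\<lambda>_. 1) \<omega>)\<^sup>2)
      = (\<Sum>j=1..d. \<Sum>l=1..d. expectation (\<lambda>\<omega>. coef j (\<lambda>_. 1) \<omega> * coef l (\<lambda>_. 1) \<omega>))"
    unfolding sq
    by (subst Bochner_Integration.integral_sum, intro Bochner_Integration.integrable_sum int, assumption, assumption)
      (intro sum.cong refl Bochner_Integration.integral_sum int)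
  also have "\<dots> = (\<Sum>j=1..d. \<Sum>l=1..d. if l = j then 1 / 3 else 0)"
    by (intro sum.cong refl) (auto simp: expectation_coef_one)
  also have "\<dots> = real d / 3" by simp
  finally have E: "expectation (\<lambda>\<omega>. (\<Sum>j=1..d. coef j (\<lambda>_. 1) \<omega>)\<^sup>2) = real d / 3" .
  show "integrable M (\<lambda>\<omega>. L2_inner d (sample d \<omega>) (sample d \<omega>))"
    unfolding L2_inner_field_field by (intro Bochner_Integration.integrable_add expectation_centered_energy int2)
  show "expectation (\<lambda>\<omega>. L2_inner d (sample d \<omega>) (sample d \<omega>)) = real d / 2"
    unfolding L2_inner_field_field using expectation_centered_energy[of d] int2 E
    by (subst Bochner_Integration.integral_add) auto
qed

lemma approx_error_0: "approx_error M d (additive_field B d) 0 = sqrt (real d / 2)"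
  using root_mean_square_eq[OF refl expectation_field_square(1), of d] expectation_field_square(2)[of d]
  by (simp add: approx_error_def)

text \<open>The extra function in \<open>Suc (card S)\<close> is the constant. Its coefficient
  removes the sum of the means exactly, leaving the centred variance d/6, from which each pair in S
  removes one eigenvalue.\<close>

lemma approx_error_upper:
  assumes S: "finite S" "S \<subseteq> {1..d} \<times> {1..}"
  shows "approx_error M d (additive_field B d) (Suc (card S)) \<le> sqrt (real d / 6 - (\<Sum>(j, k)\<in>S. eigval k))"
proof -
  let ?I = "insert None (Some ` S)"
  have sub: "i \<in> ?I \<Longrightarrow> i \<in> insert None (Some ` ({1..d} \<times> {1..}))" for i
    using S(2) by auto
  have "card ?I = Suc (card S)"
    using S(1) by (simp add: card_image)
  then obtain h where h: "bij_betw h {1..Suc (card S)} ?I"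
    using ex_bij_betw_nat_finite_1[of ?I] S(1) by auto
  let ?R = "\<lambda>\<omega>. (\<Sum>j=1..d. energy j \<omega> - (coef j (\<lambda>_. 1) \<omega>)\<^sup>2) - (\<Sum>(j, k)\<in>S. (coef j (cosine k) \<omega>)\<^sup>2)"
  let ?V = "\<lambda>t \<omega>. additive_field B d t \<omega> - (\<Sum>m=1..Suc (card S). L2_inner d (sample d \<omega>) (coord_basis (h m)) * coord_basis (h m) t)"
  have L2: "L2_inner d (\<lambda>t. ?V t \<omega>) (\<lambda>t. ?V t \<omega>) = ?R \<omega>" for \<omega>
  proof -
    have "(\<Sum>m=1..Suc (card S). L2_inner d (sample d \<omega>) (coord_basis (h m)) * coord_basis (h m) t)
        = (\<Sum>i\<in>?I. L2_inner d (sample d \<omega>) (coord_basis i) * coord_basis i t)" for t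
      using sum.reindex_bij_betw[OF h] .
    then have "L2_inner d (\<lambda>t. ?V t \<omega>) (\<lambda>t. ?V t \<omega>)
        = L2_inner d (sample d \<omega>) (sample d \<omega>) - (\<Sum>i\<in>?I. (L2_inner d (sample d \<omega>) (coord_basis i))\<^sup>2)"
      using S(1) by (simp only:)
        (intro L2_projection_residual coord_basis_L2 coord_basis_orthonormal L2_space_field sub, auto)
    also have "(\<Sum>i\<in>?I. (L2_inner d (sample d \<omega>) (coord_basis i))\<^sup>2)
        = (\<Sum>j=1..d. coef j (\<lambda>_. 1) \<omega>)\<^sup>2 + (\<Sum>p\<in>S. (L2_inner d (sample d \<omega>) (coord_basis (Some p)))\<^sup>2)"
      using S(1) by (simp add: sum.reindex L2_inner_field_one image_iff)
    also have "(\<Sum>p\<in>S. (L2_inner d (sample d \<omega>) (coord_basis (Some p)))\<^sup>2) = (\<Sum>(j, k)\<in>S. (coef j (cosine k) \<omega>)\<^sup>2)"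
      using S(2) by (intro sum.cong refl) (auto simp: L2_inner_field_cosine)
    finally show ?thesis by (simp add: L2_inner_field_field)
  qed
  have intS: "integrable M (\<lambda>\<omega>. \<Sum>(j, k)\<in>S. (coef j (cosine k) \<omega>)\<^sup>2)"
    unfolding case_prod_beta' using S(2)
    by (intro Bochner_Integration.integrable_sum integrable_coef_square continuous_on_cosine) auto
  have "expectation (\<lambda>\<omega>. \<Sum>(j, k)\<in>S. (coef j (cosine k) \<omega>)\<^sup>2)
      = (\<Sum>p\<in>S. expectation (\<lambda>\<omega>. (coef (fst p) (cosine (snd p)) \<omega>)\<^sup>2))"
    unfolding case_prod_beta' using S(2)
    by (intro Bochner_Integration.integral_sum integrable_coef_square continuous_on_cosine) auto
  also have "\<dots> = (\<Sum>(j, k)\<in>S. eigval k)"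
    using S(2) expectation_coef_cosine by (intro sum.cong refl) (auto simp: power2_eq_square)
  finally have ES: "expectation (\<lambda>\<omega>. \<Sum>(j, k)\<in>S. (coef j (cosine k) \<omega>)\<^sup>2) = (\<Sum>(j, k)\<in>S. eigval k)" .
  have "integrable M ?R"
    using expectation_centered_energy(1) intS by (rule Bochner_Integration.integrable_diff)
  from root_mean_square_eq[OF L2 this]
  have "root_mean_square M d ?V = sqrt (real d / 6 - (\<Sum>(j, k)\<in>S. eigval k))"
    using expectation_centered_energy[of d] intS ES by (simp add: Bochner_Integration.integral_diff)
  moreover have "approx_error M d (additive_field B d) (Suc (card S)) \<le> root_mean_square M d ?V"
  proof (rule approx_error_le)
    fix m assume "m \<in> {1..Suc (card S)}"
    then show "coord_basis (h m) \<in> L2_space d"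
      by (intro coord_basis_L2 sub bij_betw_apply[OF h])
  qed simp
  ultimately show ?thesis by simp
qed

section \<open>Lower bound for arbitrary approximating functions\<close>

lemma expectation_linear_combination_square:
  assumes I: "finite I" "I \<subseteq> {1..} \<times> {1..}"
  defines "X \<equiv> \<lambda>p. coef (fst p) (cosine (snd p))"
  shows "integrable M (\<lambda>\<omega>. (\<Sum>p\<in>I. X p \<omega> * a p)\<^sup>2)"
    "expectation (\<lambda>\<omega>. (\<Sum>p\<in>I. X p \<omega> * a p)\<^sup>2) = (\<Sum>p\<in>I. eigval (snd p) * (a p)\<^sup>2)"
proof -
  have sq: "(\<Sum>p\<in>I. X p \<omega> * a p)\<^sup>2 = (\<Sum>p\<in>I. \<Sum>q\<in>I. a p * a q * (X p \<omega> * X q \<omega>))" for \<omega>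
    by (simp add: power2_eq_square sum_product mult_ac)
  have int: "integrable M (\<lambda>\<omega>. a p * a q * (X p \<omega> * X q \<omega>))" if "p \<in> I" "q \<in> I" for p q
    using that I(2) unfolding X_def by (intro integrable_mult_right integrable_coef_coef continuous_on_cosine) auto
  show "integrable M (\<lambda>\<omega>. (\<Sum>p\<in>I. X p \<omega> * a p)\<^sup>2)"
    unfolding sq by (intro Bochner_Integration.integrable_sum int)
  have "expectation (\<lambda>\<omega>. (\<Sum>p\<in>I. X p \<omega> * a p)\<^sup>2)
      = (\<Sum>p\<in>I. \<Sum>q\<in>I. expectation (\<lambda>\<omega>. a p * a q * (X p \<omega> * X q \<omega>)))"
    unfolding sq
    by (subst Bochner_Integration.integral_sum, intro Bochner_Integration.integrable_sum int, assumption, assumption)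
      (intro sum.cong refl Bochner_Integration.integral_sum int)
  also have "\<dots> = (\<Sum>p\<in>I. \<Sum>q\<in>I. if q = p then eigval (snd p) * (a p)\<^sup>2 else 0)"
  proof (intro sum.cong refl)
    fix p q assume "p \<in> I" "q \<in> I"
    with I(2) have "1 \<le> fst p" "1 \<le> snd p" "1 \<le> fst q" "1 \<le> snd q" by auto
    then show "expectation (\<lambda>\<omega>. a p * a q * (X p \<omega> * X q \<omega>)) = (if q = p then eigval (snd p) * (a p)\<^sup>2 else 0)"
      using expectation_coef_cosine[of "fst p" "fst q" "snd p" "snd q"]
      by (auto simp: X_def power2_eq_square)
  qed
  also have "\<dots> = (\<Sum>p\<in>I. eigval (snd p) * (a p)\<^sup>2)"
    using I(1) by simp
  finally show "expectation (\<lambda>\<omega>. (\<Sum>p\<in>I. X p \<omega> * a p)\<^sup>2) = (\<Sum>p\<in>I. eigval (snd p) * (a p)\<^sup>2)" .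
qed

text \<open>
  Only the projection of the residual onto the centred cosine modes is estimated. Their coefficients
  are exactly uncorrelated, whereas the constant mode is correlated with them and is dropped.
\<close>

lemma residual_lower_truncated:
  assumes \<psi>: "\<And>m. m \<in> {1..n} \<Longrightarrow> \<psi> m \<in> L2_space d" and \<mu>: "0 \<le> \<mu>"
  shows "ennreal (real d * eigsum N - real d * (\<Sum>k=1..N. max (eigval k - \<mu>) 0) - \<mu> * real n)
    \<le> (\<integral>\<^sup>+\<omega>. ennreal ((L2_norm d (\<lambda>t. additive_field B d t \<omega>
          - (\<Sum>m=1..n. L2_inner d (sample d \<omega>) (\<psi> m) * \<psi> m t)))\<^sup>2) \<partial>M)"
proof -
  let ?I = "{1..d} \<times> {1..N}"
  let ?X = "\<lambda>p. coef (fst p) (cosine (snd p))"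
  let ?e = "\<lambda>p. coord_basis (Some p)"
  let ?r = "\<lambda>\<omega> t. additive_field B d t \<omega> - (\<Sum>m=1..n. L2_inner d (sample d \<omega>) (\<psi> m) * \<psi> m t)"
  have fin: "finite ?I" by simp
  have e: "?e p \<in> L2_space d" if "p \<in> ?I" for p
    using that by (intro coord_basis_L2) auto
  have orth_e: "L2_inner d (?e p) (?e q) = of_bool (p = q)" if "p \<in> ?I" "q \<in> ?I" for p q
    using that by (subst coord_basis_orthonormal) auto
  \<comment> \<open>The coordinate vectors of the \<psi>, shifted to start at index 0 as the
    orthogonalisation expects.\<close>
  define a where "a m p = L2_inner d (\<psi> (Suc m)) (?e p)" for m p
  obtain \<phi> where \<phi>: "(\<forall>l<n. \<forall>m<n. l \<noteq> m \<longrightarrow> (\<Sum>p\<in>?I. \<phi> l p * \<phi> m p) = 0) \<and>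
             (\<forall>l<n. (\<Sum>p\<in>?I. (\<phi> l p)\<^sup>2) \<in> {0, 1}) \<and>
             (\<forall>m<n. \<exists>c. \<forall>p\<in>?I. a m p = (\<Sum>l<n. c l * \<phi> l p))"
    using gram_schmidt_finite[OF fin, of n a] by (elim exE)
  then have orth: "l < n \<Longrightarrow> m < n \<Longrightarrow> l \<noteq> m \<Longrightarrow> (\<Sum>p\<in>?I. \<phi> l p * \<phi> m p) = 0"
    and norm: "l < n \<Longrightarrow> (\<Sum>p\<in>?I. (\<phi> l p)\<^sup>2) \<in> {0, 1}" for l m
    by auto
  from \<phi> have "\<forall>m<n. \<exists>c. \<forall>p\<in>?I. a m p = (\<Sum>l<n. c l * \<phi> l p)"
    by (elim conjE)
  then obtain c where c: "a m p = (\<Sum>l<n. c m l * \<phi> l p)" if "m < n" "p \<in> ?I" for m p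
    by metis
  \<comment> \<open>Q is the squared distance of the coefficient vector from the span of the \<phi>,
    a lower bound for the squared residual that depends on the \<psi> through this span
    alone.\<close>
  define Q where "Q \<omega> = (\<Sum>p\<in>?I. (?X p \<omega>)\<^sup>2) - (\<Sum>l<n. (\<Sum>p\<in>?I. ?X p \<omega> * \<phi> l p)\<^sup>2)" for \<omega>
  have Q_le: "Q \<omega> \<le> L2_inner d (?r \<omega>) (?r \<omega>)" for \<omega>
  proof -
    let ?y = "\<lambda>m. L2_inner d (sample d \<omega>) (\<psi> (Suc m))"
    define z where "z l = (\<Sum>m<n. ?y m * c m l)" for l
    have P: "(\<lambda>t. \<Sum>m=1..n. L2_inner d (sample d \<omega>) (\<psi> m) * \<psi> m t) \<in> L2_space d"
      by (intro L2_space_sum L2_space_cmult \<psi>)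
    have r: "?r \<omega> \<in> L2_space d"
      by (intro L2_space_diff L2_space_field P)
    have coord: "L2_inner d (?r \<omega>) (?e p) = ?X p \<omega> - (\<Sum>l<n. z l * \<phi> l p)" if p: "p \<in> ?I" for p
    proof -
      have "L2_inner d (?r \<omega>) (?e p) = L2_inner d (sample d \<omega>) (?e p)
          - (\<Sum>m=1..n. L2_inner d (sample d \<omega>) (\<psi> m) * L2_inner d (\<psi> m) (?e p))"
        by (subst L2_inner_diff_left[OF L2_space_field P e[OF p]], subst L2_inner_sum_left[OF \<psi> e[OF p]]) auto
      also have "L2_inner d (sample d \<omega>) (?e p) = ?X p \<omega>"
        using p by (cases p) (auto simp: L2_inner_field_cosine)
      also have "(\<Sum>m=1..n. L2_inner d (sample d \<omega>) (\<psi> m) * L2_inner d (\<psi> m) (?e p)) = (\<Sum>m<n. ?y m * a m p)"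
        unfolding a_def by (rule sum.reindex_bij_witness[of _ Suc "\<lambda>m. m - 1"]) auto
      also have "\<dots> = (\<Sum>m<n. \<Sum>l<n. ?y m * c m l * \<phi> l p)"
        using c p by (intro sum.cong refl) (simp add: sum_distrib_left mult.assoc)
      also have "\<dots> = (\<Sum>l<n. z l * \<phi> l p)"
        by (subst sum.swap) (simp add: z_def sum_distrib_right)
      finally show ?thesis .
    qed
    have "Q \<omega> \<le> (\<Sum>p\<in>?I. (?X p \<omega> - (\<Sum>l<n. z l * \<phi> l p))\<^sup>2)"
      unfolding Q_def using fin orth norm by (rule orthonormal_residual)
    also have "\<dots> = (\<Sum>p\<in>?I. (L2_inner d (?r \<omega>) (?e p))\<^sup>2)"
      by (intro sum.cong refl) (simp only: coord)
    also have "\<dots> \<le> L2_inner d (?r \<omega>) (?r \<omega>)"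
      using fin e r orth_e by (rule L2_Bessel)
    finally show ?thesis .
  qed
  have I_pos: "?I \<subseteq> {1..} \<times> {1..}" by auto
  note lin = expectation_linear_combination_square[OF fin I_pos]
  have intX: "integrable M (\<lambda>\<omega>. (?X p \<omega>)\<^sup>2)" if "p \<in> ?I" for p
    using that by (intro integrable_coef_square continuous_on_cosine) auto
  have int1: "integrable M (\<lambda>\<omega>. \<Sum>p\<in>?I. (?X p \<omega>)\<^sup>2)"
    by (intro Bochner_Integration.integrable_sum intX)
  have int2: "integrable M (\<lambda>\<omega>. \<Sum>l<n. (\<Sum>p\<in>?I. ?X p \<omega> * \<phi> l p)\<^sup>2)"
    by (intro Bochner_Integration.integrable_sum lin(1))
  have intQ: "integrable M Q"
    unfolding Q_def by (intro Bochner_Integration.integrable_diff int1 int2)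
  \<comment> \<open>\<open>w p\<close> is the share of mode p captured by the subspace. The only
    facts used about it are that it lies in [0,1] and that its total is at most n.\<close>
  define w where "w p = (\<Sum>l<n. (\<phi> l p)\<^sup>2)" for p
  have "expectation (\<lambda>\<omega>. \<Sum>p\<in>?I. (?X p \<omega>)\<^sup>2) = (\<Sum>p\<in>?I. expectation (\<lambda>\<omega>. (?X p \<omega>)\<^sup>2))"
    by (intro Bochner_Integration.integral_sum intX)
  also have "\<dots> = (\<Sum>p\<in>?I. eigval (snd p))"
    using expectation_coef_cosine by (intro sum.cong refl) (auto simp: power2_eq_square)
  finally have E1: "expectation (\<lambda>\<omega>. \<Sum>p\<in>?I. (?X p \<omega>)\<^sup>2) = (\<Sum>p\<in>?I. eigval (snd p))" .
  have "expectation (\<lambda>\<omega>. \<Sum>l<n. (\<Sum>p\<in>?I. ?X p \<omega> * \<phi> l p)\<^sup>2)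
      = (\<Sum>l<n. expectation (\<lambda>\<omega>. (\<Sum>p\<in>?I. ?X p \<omega> * \<phi> l p)\<^sup>2))"
    by (intro Bochner_Integration.integral_sum lin(1))
  also have "\<dots> = (\<Sum>l<n. \<Sum>p\<in>?I. eigval (snd p) * (\<phi> l p)\<^sup>2)"
    by (intro sum.cong refl lin(2))
  also have "\<dots> = (\<Sum>p\<in>?I. eigval (snd p) * w p)"
    by (subst sum.swap) (simp add: w_def sum_distrib_left)
  finally have E2: "expectation (\<lambda>\<omega>. \<Sum>l<n. (\<Sum>p\<in>?I. ?X p \<omega> * \<phi> l p)\<^sup>2) = (\<Sum>p\<in>?I. eigval (snd p) * w p)" .
  have EQ: "expectation Q = (\<Sum>p\<in>?I. eigval (snd p)) - (\<Sum>p\<in>?I. eigval (snd p) * w p)"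
    unfolding Q_def by (subst Bochner_Integration.integral_diff[OF int1 int2]) (simp only: E1 E2)
  have sum_I: "(\<Sum>p\<in>?I. g (snd p)) = real d * (\<Sum>k=1..N. g k)" for g :: "nat \<Rightarrow> real"
    using sum.cartesian_product[of "\<lambda>_ k. g k" "{1..N}" "{1..d}"] by (simp add: case_prod_beta')
  have w1: "w p \<le> 1" if "p \<in> ?I" for p
    unfolding w_def using fin orth norm that by (rule orthonormal_coordinate_le_1)
  have w0: "0 \<le> w p" for p
    unfolding w_def by (intro sum_nonneg) auto
  have "(\<Sum>p\<in>?I. w p) = (\<Sum>l<n. \<Sum>p\<in>?I. (\<phi> l p)\<^sup>2)"
    unfolding w_def by (rule sum.swap)
  also have "\<dots> \<le> (\<Sum>l<n. 1)"
    using norm by (intro sum_mono) force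
  finally have wn: "(\<Sum>p\<in>?I. w p) \<le> real n" by simp
  \<comment> \<open>A Lagrange multiplier argument replaces sorting the eigenvalues: each captured
    unit is charged the price \<mu>, and only modes above the price can yield a surplus.\<close>
  have "(\<Sum>p\<in>?I. eigval (snd p) * w p) \<le> (\<Sum>p\<in>?I. max (eigval (snd p) - \<mu>) 0 + \<mu> * w p)"
  proof (intro sum_mono)
    fix p assume p: "p \<in> ?I"
    have "(eigval (snd p) - \<mu>) * w p \<le> max (eigval (snd p) - \<mu>) 0 * w p"
      using w0 by (intro mult_right_mono) auto
    also have "\<dots> \<le> max (eigval (snd p) - \<mu>) 0"
      using w1[OF p] w0 by (intro mult_left_le) auto
    finally show "eigval (snd p) * w p \<le> max (eigval (snd p) - \<mu>) 0 + \<mu> * w p"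
      by (simp add: left_diff_distrib)
  qed
  also have "\<dots> = real d * (\<Sum>k=1..N. max (eigval k - \<mu>) 0) + \<mu> * (\<Sum>p\<in>?I. w p)"
    by (simp only: sum.distrib sum_distrib_left[symmetric] sum_I[of "\<lambda>k. max (eigval k - \<mu>) 0"])
  also have "\<dots> \<le> real d * (\<Sum>k=1..N. max (eigval k - \<mu>) 0) + \<mu> * real n"
    using wn \<mu> by (intro add_left_mono mult_left_mono)
  finally have "real d * eigsum N - real d * (\<Sum>k=1..N. max (eigval k - \<mu>) 0) - \<mu> * real n \<le> expectation Q"
    unfolding EQ sum_I eigsum_def by linarith
  \<comment> \<open>The positive part makes the passage to \<open>nn_integral\<close> possible and
    stays below the squared residual, which is nonnegative.\<close>
  also have "\<dots> \<le> expectation (\<lambda>\<omega>. max (Q \<omega>) 0)"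
    using intQ by (intro integral_mono) auto
  finally have "ennreal (real d * eigsum N - real d * (\<Sum>k=1..N. max (eigval k - \<mu>) 0) - \<mu> * real n)
      \<le> ennreal (expectation (\<lambda>\<omega>. max (Q \<omega>) 0))"
    by (rule ennreal_leI)
  also have "\<dots> = (\<integral>\<^sup>+\<omega>. ennreal (max (Q \<omega>) 0) \<partial>M)"
    using intQ by (intro nn_integral_eq_integral[symmetric]) auto
  also have "\<dots> \<le> (\<integral>\<^sup>+\<omega>. ennreal ((L2_norm d (?r \<omega>))\<^sup>2) \<partial>M)"
    unfolding L2_norm_power2 using Q_le L2_inner_nonneg
    by (intro nn_integral_mono ennreal_leI) simp
  finally show ?thesis .
qed

text \<open>With the price \<open>eigval (Suc K)\<close> only the first K modes of each coordinate
  yield a surplus, so the surplus is bounded independently of the truncation N, and N can tend to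
  infinity. If the argument of \<open>sqrt\<close> is negative, so is the bound, and it holds
  trivially.\<close>

lemma approx_error_lower:
  assumes n: "n \<noteq> 0"
  shows "sqrt (real d / 6 - real d * (\<Sum>k=1..K. eigval k - eigval (Suc K)) - eigval (Suc K) * real n)
    \<le> approx_error M d (additive_field B d) n"
proof (rule approx_error_ge[OF _ n])
  fix \<psi> :: "nat \<Rightarrow> (nat \<Rightarrow> real) \<Rightarrow> real"
  assume \<psi>: "\<And>m. m \<in> {1..n} \<Longrightarrow> \<psi> m \<in> L2_space d"
  let ?\<mu> = "eigval (Suc K)"
  let ?r = "\<lambda>\<omega> t. additive_field B d t \<omega> - (\<Sum>m=1..n. L2_inner d (sample d \<omega>) (\<psi> m) * \<psi> m t)"
  let ?J = "\<integral>\<^sup>+\<omega>. ennreal ((L2_norm d (?r \<omega>))\<^sup>2) \<partial>M"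
  let ?T = "real d * (\<Sum>k=1..K. eigval k - ?\<mu>)"
  define C where "C = 2 + 2 * (\<Sum>m\<in>{1..n}. L2_inner d (\<psi> m) (\<psi> m))\<^sup>2"
  have "?J \<le> (\<integral>\<^sup>+\<omega>. ennreal (C * L2_inner d (sample d \<omega>) (sample d \<omega>)) \<partial>M)"
    unfolding L2_norm_power2 C_def
    by (intro nn_integral_mono ennreal_leI L2_residual_bound L2_space_field \<psi>)
  also have "\<dots> = ennreal (expectation (\<lambda>\<omega>. C * L2_inner d (sample d \<omega>) (sample d \<omega>)))"
    using expectation_field_square(1) L2_inner_nonneg
    by (intro nn_integral_eq_integral) (auto simp: C_def intro!: AE_I2 mult_nonneg_nonneg)
  finally have fin: "?J < top"
    using le_less_trans by fastforce
  have "real d * eigsum N - ?T - ?\<mu> * real n \<le> enn2real ?J" for N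
  proof -
    let ?T' = "real d * (\<Sum>k=1..N. max (eigval k - ?\<mu>) 0)"
    have "(\<Sum>k=1..N. max (eigval k - ?\<mu>) 0) \<le> (\<Sum>k=1..K. eigval k - ?\<mu>)"
    proof -
      have big: "max (eigval k - ?\<mu>) 0 = eigval k - ?\<mu>" if "k \<in> {1..K}" for k
        using eigval_antimono[of k "Suc K"] that by auto
      have small: "max (eigval k - ?\<mu>) 0 = 0" if "k \<notin> {1..K}" "1 \<le> k" for k
        using eigval_antimono[of "Suc K" k] that by auto
      have "(\<Sum>k=1..N. max (eigval k - ?\<mu>) 0) \<le> (\<Sum>k=1..max N K. max (eigval k - ?\<mu>) 0)"
        by (intro sum_mono2) auto
      also have "\<dots> = (\<Sum>k=1..K. max (eigval k - ?\<mu>) 0)"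
        using small by (intro sum.mono_neutral_right) auto
      also have "\<dots> = (\<Sum>k=1..K. eigval k - ?\<mu>)"
        by (intro sum.cong refl big)
      finally show ?thesis .
    qed
    then have "?T' \<le> ?T" by (intro mult_left_mono) auto
    then have "real d * eigsum N - ?T - ?\<mu> * real n \<le> real d * eigsum N - ?T' - ?\<mu> * real n" by simp
    also have "\<dots> \<le> enn2real (ennreal (real d * eigsum N - ?T' - ?\<mu> * real n))"
      by (cases "0 \<le> real d * eigsum N - ?T' - ?\<mu> * real n") (auto intro: order_trans[OF _ enn2real_nonneg])
    also have "\<dots> \<le> enn2real ?J"
      using residual_lower_truncated[OF \<psi> eigval_nonneg, of n] fin by (intro enn2real_mono) auto
    finally show ?thesis .
  qed
  moreover have "(\<lambda>N. real d * eigsum N - ?T - ?\<mu> * real n) \<longlonglongrightarrow> real d * (1 / 6) - ?T - ?\<mu> * real n"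
    by (intro tendsto_intros eigsum_LIMSEQ)
  ultimately have "real d * (1 / 6) - ?T - ?\<mu> * real n \<le> enn2real ?J"
    by (intro LIMSEQ_le_const2) auto
  then show "sqrt (real d / 6 - ?T - ?\<mu> * real n) \<le> root_mean_square M d (\<lambda>t \<omega>. ?r \<omega> t)"
    by (simp add: root_mean_square_def)
qed

section \<open>The complexity of the additive field\<close>

lemma complexity_eq_1:
  assumes \<epsilon>: "0 < \<epsilon>" "1 \<le> 3 * \<epsilon>\<^sup>2"
  shows "approx_complexity M d (additive_field B d) \<epsilon> = 1"
proof -
  have "approx_error M d (additive_field B d) 1 \<le> sqrt (real d / 6)"
    using approx_error_upper[of "{}" d] by simp
  also have "\<dots> \<le> sqrt (\<epsilon>\<^sup>2 * (real d / 2))"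
    using mult_right_mono[OF \<epsilon>(2), of "real d"] by (simp add: algebra_simps)
  also have "\<dots> = \<epsilon> * approx_error M d (additive_field B d) 0"
    using \<epsilon> unfolding approx_error_0 real_sqrt_mult by simp
  finally show ?thesis
    unfolding approx_complexity_def by (intro Least_equality) auto
qed

text \<open>The optimal choice takes the first K modes of all coordinates and mode
  \<open>Suc K\<close> of just as many coordinates as needed. The 2 in the upper bound pays for the
  constant function and for rounding that number up.\<close>

lemma complexity_bounds:
  assumes \<epsilon>: "0 < \<epsilon>" "3 * \<epsilon>\<^sup>2 < 1"
  shows "real d * Wiener_q \<epsilon> \<le> real (approx_complexity M d (additive_field B d) \<epsilon>)"
    and "real (approx_complexity M d (additive_field B d) \<epsilon>) \<le> real d * Wiener_q \<epsilon> + 2"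
proof -
  \<comment> \<open>The variance to be captured per coordinate: what is left, d/6 - d x, is exactly
    \<epsilon>^2 times the total d/2.\<close>
  define x where "x = 1 / 6 - \<epsilon>\<^sup>2 / 2"
  have "0 < x" "x < 1 / 6"
    using \<epsilon> zero_less_power[of \<epsilon> 2] unfolding x_def by linarith+
  then obtain K where K: "eigsum K < x" "x \<le> eigsum (Suc K)"
    by (rule exists_eigsum_bracket)
  let ?\<mu> = "eigval (Suc K)"
  have \<mu>: "0 < ?\<mu>" by (simp add: eigval_pos)
  have q: "Wiener_q \<epsilon> = real K + (x - eigsum K) / ?\<mu>"
    using Wiener_q_eq K by (simp add: x_def)
  \<comment> \<open>The real number of copies of \<open>eigval (Suc K)\<close> still missing after K
    full modes per coordinate. It is at most d, so enough coordinates are available even after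
    rounding up.\<close>
  define y where "y = real d * ((x - eigsum K) / ?\<mu>)"
  have y0: "0 \<le> y" using K \<mu> by (simp add: y_def)
  have "(x - eigsum K) / ?\<mu> \<le> 1" using K \<mu> by (simp add: eigsum_Suc)
  then have yd: "y \<le> real d"
    unfolding y_def by (intro mult_left_le) auto
  define r where "r = nat \<lceil>y\<rceil>"
  have r: "y \<le> real r" "real r \<le> y + 1" "r \<le> d"
    using y0 yd unfolding r_def by linarith+
  let ?P = "\<lambda>n. 1 \<le> n \<and> approx_error M d (additive_field B d) n \<le> \<epsilon> * approx_error M d (additive_field B d) 0"
  have e0: "\<epsilon> * approx_error M d (additive_field B d) 0 = sqrt (real d / 6 - real d * x)"
  proof -
    have "\<epsilon> * approx_error M d (additive_field B d) 0 = sqrt (\<epsilon>\<^sup>2 * (real d / 2))"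
      using \<epsilon> unfolding approx_error_0 real_sqrt_mult by simp
    also have "\<epsilon>\<^sup>2 * (real d / 2) = real d / 6 - real d * x"
      by (simp add: x_def algebra_simps)
    finally show ?thesis .
  qed
  define S where "S = {1..d} \<times> {1..K} \<union> {1..r} \<times> {Suc K}"
  have S: "finite S" "S \<subseteq> {1..d} \<times> {1..}"
    using r(3) by (auto simp: S_def)
  have disj: "({1..d} \<times> {1..K}) \<inter> ({1..r} \<times> {Suc K}) = {}" by auto
  have card: "card S = d * K + r"
    unfolding S_def using disj by (subst card_Un_disjoint) (auto simp: card_cartesian_product)
  have "(\<Sum>(j, k)\<in>S. eigval k) = (\<Sum>(j, k)\<in>{1..d} \<times> {1..K}. eigval k) + (\<Sum>(j, k)\<in>{1..r} \<times> {Suc K}. eigval k)"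
    unfolding S_def using disj by (intro sum.union_disjoint) auto
  also have "\<dots> = real d * eigsum K + real r * ?\<mu>"
    by (simp add: sum.cartesian_product[symmetric] eigsum_def)
  finally have sum_S: "(\<Sum>(j, k)\<in>S. eigval k) = real d * eigsum K + real r * ?\<mu>" .
  have "real d * (x - eigsum K) = y * ?\<mu>"
    using \<mu> by (simp add: y_def)
  also have "\<dots> \<le> real r * ?\<mu>"
    using r(1) \<mu> by (intro mult_right_mono) auto
  finally have "real d * x \<le> (\<Sum>(j, k)\<in>S. eigval k)"
    unfolding sum_S by (simp add: algebra_simps)
  then have "sqrt (real d / 6 - (\<Sum>(j, k)\<in>S. eigval k)) \<le> sqrt (real d / 6 - real d * x)"
    by simp
  then have P: "?P (Suc (card S))"
    unfolding e0 using order_trans[OF approx_error_upper[OF S]] by simp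
  have "approx_complexity M d (additive_field B d) \<epsilon> \<le> Suc (card S)"
    unfolding approx_complexity_def using P by (rule Least_le)
  then have "real (approx_complexity M d (additive_field B d) \<epsilon>) \<le> real (Suc (card S))"
    by simp
  also have "\<dots> \<le> real d * Wiener_q \<epsilon> + 2"
    using r(2) by (simp add: card q y_def algebra_simps)
  finally show "real (approx_complexity M d (additive_field B d) \<epsilon>) \<le> real d * Wiener_q \<epsilon> + 2" .
  define n where "n = approx_complexity M d (additive_field B d) \<epsilon>"
  have Pn: "?P n"
    unfolding n_def approx_complexity_def using P by (rule LeastI)
  \<comment> \<open>The price used here is the eigenvalue that is only partly exhausted. With it the
    inequality, solved for n, gives d q exactly, without any rounding loss.\<close>
  then have "sqrt (real d / 6 - real d * (\<Sum>k=1..K. eigval k - ?\<mu>) - ?\<mu> * real n) \<le> sqrt (real d / 6 - real d * x)"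
    using approx_error_lower[of n d K] unfolding e0 by linarith
  then have "real d * x - real d * (\<Sum>k=1..K. eigval k - ?\<mu>) \<le> ?\<mu> * real n"
    by simp
  also have "(\<Sum>k=1..K. eigval k - ?\<mu>) = eigsum K - real K * ?\<mu>"
    by (simp add: sum_subtractf eigsum_def)
  finally have "real d * (real K * ?\<mu> + (x - eigsum K)) \<le> real n * ?\<mu>"
    by (simp add: algebra_simps)
  then have "real d * (real K * ?\<mu> + (x - eigsum K)) / ?\<mu> \<le> real n"
    using \<mu> by (simp add: pos_divide_le_eq)
  also have "real d * (real K * ?\<mu> + (x - eigsum K)) / ?\<mu> = real d * Wiener_q \<epsilon>"
    using \<mu> by (simp add: q field_simps)
  finally show "real d * Wiener_q \<epsilon> \<le> real (approx_complexity M d (additive_field B d) \<epsilon>)"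
    unfolding n_def .
qed

end

lemma three_powr_minus_half: "(3 powr (-1/2) :: real)\<^sup>2 = 1 / 3"
proof -
  have "(3 powr (-1/2) :: real)\<^sup>2 = 3 powr (-1)"
    by (simp add: power2_eq_square powr_add[symmetric])
  then show ?thesis by (simp add: powr_minus)
qed

theorem mainTheorem4:
  fixes M :: "'a measure" and W :: "nat \<Rightarrow> real \<Rightarrow> 'a \<Rightarrow> real"
  assumes "prob_space M"
    and "\<And>j. j \<ge> 1 \<Longrightarrow> standard_Wiener M (W j)"
    and "uncorrelated_processes M {1..} W"
  shows "(\<forall>\<epsilon>\<in>{3 powr (-1/2)..<1}. \<forall>d\<ge>1. approx_complexity M d (additive_field W d) \<epsilon> = 1) \<and>
    (\<forall>\<epsilon>\<in>{0<..<3 powr (-1/2)}.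
       (\<lambda>d. real (approx_complexity M d (additive_field W d) \<epsilon>)) \<sim>[at_top] (\<lambda>d. real d * Wiener_q \<epsilon>)) \<and>
    Wiener_q \<sim>[at_right 0] (\<lambda>\<epsilon>. 2 / pi\<^sup>2 * \<epsilon> powr (-2))"
proof -
  obtain B where B: "continuous_wiener_family M B"
    and eq: "AE \<omega> in M. \<forall>j\<ge>1. \<forall>t\<in>{0..1}. B j t \<omega> = W j t \<omega>"
    using exists_continuous_wiener_family[OF assms] by blast
  interpret continuous_wiener_family M B by (rule B)
  have "approx_error M d (additive_field W d) n = approx_error M d (additive_field B d) n" for d n
  proof (rule approx_error_cong_AE)
    show "AE \<omega> in M. \<forall>t\<in>space (cube d). additive_field W d t \<omega> = additive_field B d t \<omega>"
      using eq
    proof eventually_elim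
      case (elim \<omega>)
      show ?case
      proof
        fix t assume "t \<in> space (cube d)"
        then have "t j \<in> {0..1}" if "j \<in> {1..d}" for j
          using that by (auto simp: cube_def space_PiM space_unit_interval PiE_iff)
        with elim show "additive_field W d t \<omega> = additive_field B d t \<omega>"
          unfolding additive_field_def by (intro sum.cong refl) simp
      qed
    qed
  qed
  then have complexity: "approx_complexity M d (additive_field W d) \<epsilon> = approx_complexity M d (additive_field B d) \<epsilon>" for d \<epsilon>
    by (simp add: approx_complexity_def)
  have pos: "(0::real) < 3 powr (-1/2)" by simp
  have "approx_complexity M d (additive_field W d) \<epsilon> = 1" if "\<epsilon> \<in> {3 powr (-1/2)..<1}" for \<epsilon> d
  proof -
    have "(3 powr (-1/2))\<^sup>2 \<le> \<epsilon>\<^sup>2"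
      using that pos by (intro power_mono) auto
    then have "1 \<le> 3 * \<epsilon>\<^sup>2"
      unfolding three_powr_minus_half by simp
    moreover have "0 < \<epsilon>" by (rule less_le_trans[OF pos]) (use that in simp)
    ultimately show ?thesis unfolding complexity by (intro complexity_eq_1)
  qed
  moreover have "(\<lambda>d. real (approx_complexity M d (additive_field W d) \<epsilon>)) \<sim>[at_top] (\<lambda>d. real d * Wiener_q \<epsilon>)"
    if \<epsilon>: "\<epsilon> \<in> {0<..<3 powr (-1/2)}" for \<epsilon>
  proof (rule asymp_equivI')
    have "\<epsilon>\<^sup>2 < (3 powr (-1/2))\<^sup>2"
      using \<epsilon> by (intro power_strict_mono) auto
    then have \<epsilon>': "0 < \<epsilon>" "3 * \<epsilon>\<^sup>2 < 1"
      using \<epsilon> unfolding three_powr_minus_half by auto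
    let ?q = "Wiener_q \<epsilon>"
    have q: "0 < ?q" by (rule Wiener_q_bounds(2)[OF \<epsilon>'])
    let ?f = "\<lambda>d. real (approx_complexity M d (additive_field W d) \<epsilon>) / (real d * ?q)"
    \<comment> \<open>The additive slack 2 of the upper bound is divided by d q with q > 0 fixed, so
      it vanishes in the limit.\<close>
    have bd: "1 \<le> ?f d \<and> ?f d \<le> 1 + 2 / (real d * ?q)" if "d > 0" for d
    proof -
      have dq: "0 < real d * ?q" using q that by simp
      have "real d * ?q / (real d * ?q) \<le> ?f d"
        using complexity_bounds(1)[OF \<epsilon>', of d] dq unfolding complexity by (intro divide_right_mono) auto
      moreover have "?f d \<le> (real d * ?q + 2) / (real d * ?q)"
        using complexity_bounds(2)[OF \<epsilon>', of d] dq unfolding complexity by (intro divide_right_mono) auto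
      moreover have "real d * ?q / (real d * ?q) = 1"
        using q that by simp
      ultimately show ?thesis unfolding add_divide_distrib by (simp only:)
    qed
    show "?f \<longlonglongrightarrow> 1"
    proof (rule tendsto_sandwich)
      show "\<forall>\<^sub>F d in sequentially. 1 \<le> ?f d"
        using eventually_gt_at_top[of 0] by eventually_elim (use bd in blast)
      show "\<forall>\<^sub>F d in sequentially. ?f d \<le> 1 + 2 / (real d * ?q)"
        using eventually_gt_at_top[of 0] by eventually_elim (use bd in blast)
      show "(\<lambda>d. 1 + 2 / (real d * ?q)) \<longlonglongrightarrow> 1"
        using q by real_asymp
    qed simp
  qed
  ultimately show ?thesis
    using Wiener_q_asymp by blast
qed

end
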